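(* Let $n\geq 1$ be a fixed integer and let $\mathcal{C}^<_n$ be the class of all finite ordered $n$-colorable graphs. Every $\mathbf{X}\in\mathcal{C}^<_n$ has a finite Ramsey degree in $\mathcal{C}^<_n$, and this degree equals $\sigma(\mathbf{X})$. That is, $\sigma(\mathbf{X})$ is the least integer $t$ such that for every $\mathbf{Y}\in\mathcal{C}^<_n$ and every $k\in\mathbb{N}$ there exists $\mathbf{Z}\in\mathcal{C}^<_n$ with $\mathbf{Z}\to(\mathbf{Y})^{\mathbf{X}}_{k,t}$.
   Context: Graphs are simple and loopless, viewed as structures $(X,E)$ with $E$ an irreflexive symmetric binary relation. An ordered graph is a graph with a linear ordering $<$ on its vertex set; $\mathcal{C}^<_n$ is the class of finite ordered graphs admitting a proper vertex coloring with $n$ colors. $[n]=\{1,\dots,n\}$. $\mathcal{K}^<_n$ is the class of finite structures $(X,E,<,\lambda)$ where $(X,E,<)$ is a finite ordered graph and $\lambda:X\to[n]$ is a map with $\lambda(x)\neq\lambda(y)$ whenever $x,y$ are adjacent. For $\mathbf{X}=(X,E^{\mathbf X},<^{\mathbf X})\in\mathcal{C}^<_n$, an extension of $\mathbf{X}$ in $\mathcal{K}^<_n$ is a structure $(X,E^{\mathbf X},<^{\mathbf X},\lambda)\in\mathcal{K}^<_n$; $\sigma(\mathbf{X})$ is the number of pairwise non-isomorphic extensions of $\mathbf{X}$ in $\mathcal{K}^<_n$ (isomorphisms preserve edges, order and the coloring $\lambda$). For structures $\mathbf{A},\mathbf{B}$ of the same kind, $\binom{\mathbf{B}}{\mathbf{A}}$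 denotes the set of induced substructures of $\mathbf{B}$ isomorphic to $\mathbf{A}$ (copies of $\mathbf A$). The notation $\mathbf{Z}\to(\mathbf{Y})^{\mathbf{X}}_{k,t}$ means: for every map $\alpha:\binom{\mathbf{Z}}{\mathbf{X}}\to[k]$ there is $\tilde{\mathbf{Y}}\in\binom{\mathbf{Z}}{\mathbf{Y}}$ such that $\alpha$ takes at most $t$ values on $\binom{\tilde{\mathbf{Y}}}{\mathbf{X}}$. An element $\mathbf X$ of a class $\mathcal K$ has finite Ramsey degree $t$ in $\mathcal K$ if $t$ is the least integer such that for all $\mathbf Y\in\mathcal K$ and $k\in\mathbb N$ there is $\mathbf Z\in\mathcal K$ with $\mathbf{Z}\to(\mathbf{Y})^{\mathbf{X}}_{k,t}$. *)

theory Defs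
  imports Main "HOL-Library.FuncSet" "HOL-Library.Infinite_Typeclass"
begin

text \<open>
  The edge relation and the strict order are relations on the vertex set itself
  (they contain no pairs outside it), so that two structures are equal as records
  iff they are equal as structures.
\<close>

record 'a ograph =
  verts :: "'a set"
  edges :: "('a \<times> 'a) set"
  lt :: "('a \<times> 'a) set"

record 'a colored_ograph = "'a ograph" +
  color :: "'a \<Rightarrow> nat"

definition finite_ograph :: "('a, 'z) ograph_scheme \<Rightarrow> bool" where
  "finite_ograph G \<longleftrightarrow>
     finite (verts G) \<and>
     edges G \<subseteq> verts G \<times> verts G \<and> irrefl (edges G) \<and> sym (edges G) \<and>
     lt G \<subseteq> verts G \<times> verts G \<and> strict_linear_order_on (verts G) (lt G)"

definition proper_coloring :: "nat \<Rightarrow> ('a, 'z) ograph_scheme \<Rightarrow> ('a \<Rightarrow> nat) \<Rightarrow> bool" where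
  "proper_coloring n G c \<longleftrightarrow>
     c \<in> verts G \<rightarrow> {1..n} \<and> (\<forall>(x, y)\<in>edges G. c x \<noteq> c y)"

text \<open>
  The class is represented by the structures on finite subsets of the type \<open>'a\<close>. Up to
  isomorphism this is the whole class provided that \<open>'a\<close> is infinite, hence the sort
  \<^class>\<open>infinite\<close> is required when the class is used.
\<close>

definition colorable_ographs :: "nat \<Rightarrow> 'a ograph set" where
  "colorable_ographs n = {G. finite_ograph G \<and> (\<exists>c. proper_coloring n G c)}"

text \<open>
  The coloring is a function on the vertex set only; outside of it, it is
  normalised to \<^const>\<open>undefined\<close>.
\<close>

definition colored_ographs :: "nat \<Rightarrow> 'a colored_ograph set" where
  "colored_ographs n =
     {G. finite_ograph G \<and> proper_coloring n G (color G) \<and> color G \<in> extensional (verts G)}"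

definition ograph_iso :: "('a \<Rightarrow> 'b) \<Rightarrow> ('a, 'z) ograph_scheme \<Rightarrow> ('b, 'w) ograph_scheme \<Rightarrow> bool" where
  "ograph_iso f A B \<longleftrightarrow>
     bij_betw f (verts A) (verts B) \<and>
     (\<forall>x\<in>verts A. \<forall>y\<in>verts A.
        ((x, y) \<in> edges A \<longleftrightarrow> (f x, f y) \<in> edges B) \<and>
        ((x, y) \<in> lt A \<longleftrightarrow> (f x, f y) \<in> lt B))"

definition ograph_isomorphic :: "'a ograph \<Rightarrow> 'b ograph \<Rightarrow> bool" where
  "ograph_isomorphic A B \<longleftrightarrow> (\<exists>f. ograph_iso f A B)"

definition colored_isomorphic :: "'a colored_ograph \<Rightarrow> 'b colored_ograph \<Rightarrow> bool" where
  "colored_isomorphic A B \<longleftrightarrow>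
     (\<exists>f. ograph_iso f A B \<and> (\<forall>x\<in>verts A. color B (f x) = color A x))"

definition extensions :: "nat \<Rightarrow> 'a ograph \<Rightarrow> 'a colored_ograph set" where
  "extensions n X = {A \<in> colored_ographs n. ograph.truncate A = X}"

definition sigma :: "nat \<Rightarrow> 'a ograph \<Rightarrow> nat" where
  "sigma n X =
     card (extensions n X //
       {(A, B). A \<in> extensions n X \<and> B \<in> extensions n X \<and> colored_isomorphic A B})"

definition induced :: "'a ograph \<Rightarrow> 'a set \<Rightarrow> 'a ograph" where
  "induced G S = \<lparr>verts = S, edges = edges G \<inter> S \<times> S, lt = lt G \<inter> S \<times> S\<rparr>"

definition copies :: "'a ograph \<Rightarrow> 'b ograph \<Rightarrow> 'b ograph set" where
  "copies A B = {C. (\<exists>S\<subseteq>verts B. C = induced B S) \<and> ograph_isomorphic A C}"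

text \<open>\<open>arrow Z Y X k t\<close> is the partition relation \<open>Z \<rightarrow> (Y)\<^sup>X\<^bsub>k,t\<^esub>\<close>.\<close>

definition arrow :: "'a ograph \<Rightarrow> 'a ograph \<Rightarrow> 'a ograph \<Rightarrow> nat \<Rightarrow> nat \<Rightarrow> bool" where
  "arrow Z Y X k t \<longleftrightarrow>
     (\<forall>\<alpha>. \<alpha> \<in> copies X Z \<rightarrow> {1..k} \<longrightarrow>
        (\<exists>Y'\<in>copies Y Z. card (\<alpha> ` copies X Y') \<le> t))"

definition ramsey_bound :: "'a ograph set \<Rightarrow> 'a ograph \<Rightarrow> nat \<Rightarrow> bool" where
  "ramsey_bound K X t \<longleftrightarrow> (\<forall>Y\<in>K. \<forall>k. \<exists>Z\<in>K. arrow Z Y X k t)"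

definition has_ramsey_degree :: "'a ograph set \<Rightarrow> 'a ograph \<Rightarrow> nat \<Rightarrow> bool" where
  "has_ramsey_degree K X t \<longleftrightarrow>
     ramsey_bound K X t \<and> (\<forall>s. ramsey_bound K X s \<longrightarrow> t \<le> s)"

end

theory Submission
  imports Defs "HOL-Library.Ramsey" "HOL-Library.Countable" "HOL-Library.Product_Lexorder"
begin

text \<open>
  Since finite linear orders are rigid, \<open>\<sigma>(X)\<close> is the number of proper \<open>n\<close>-colorings of \<open>X\<close>.

  Lower bound: let \<open>Y\<close> consist of a clique on \<open>n\<close> vertices and a copy of \<open>X\<close> for every proper
  coloring \<open>c\<close>, where the copy of \<open>x\<close> is joined to all clique vertices except the one with index
  \<open>c x\<close>. A proper coloring of \<open>Y\<close> permutes the colors of the clique, hence induces all proper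
  colorings of \<open>X\<close> on the copies of \<open>X\<close> in \<open>Y\<close>. So if \<open>Z\<close> is properly colored and each copy of \<open>X\<close>
  in \<open>Z\<close> receives the coloring induced on it, then every copy of \<open>Y\<close> in \<open>Z\<close> sees all \<open>\<sigma>(X)\<close> values.

  Upper bound: take \<open>p\<close> blocks, each split into \<open>n\<close> color classes, and place a copy of \<open>Y\<close> across
  every set of \<open>|Y|\<close> blocks. A partite construction, driven by the Hales-Jewett theorem, enlarges
  this partite graph so that in some copy of it the value of a copy of \<open>X\<close> depends only on the set
  of blocks it meets and on its vertex colors. By Ramsey's theorem some set of \<open>|Y|\<close> blocks removes
  the dependence on the blocks, which leaves one value for each proper coloring of \<open>X\<close>.
\<close>

subsection \<open>The Hales-Jewett theorem\<close>

definition words :: "nat \<Rightarrow> 'l set \<Rightarrow> 'l list set" where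
  "words N S = {u. set u \<subseteq> S \<and> length u = N}"

text \<open>Variable words: \<open>None\<close> marks the moving coordinates and \<open>Some\<close>
  the fixed ones. The second condition keeps at least one coordinate moving.\<close>

definition lines :: "nat \<Rightarrow> 'l set \<Rightarrow> 'l option list set" where
  "lines N S = {w \<in> words N (insert None (Some ` S)). None \<in> set w}"

definition inst :: "'l option list \<Rightarrow> 'l \<Rightarrow> 'l list" where
  "inst w a = map (case_option a id) w"

definition hales_jewett :: "'l set \<Rightarrow> nat \<Rightarrow> nat \<Rightarrow> bool" where
  "hales_jewett S k N \<longleftrightarrow>
     (\<forall>c. c \<in> words N S \<rightarrow> {..<k} \<longrightarrow> (\<exists>w\<in>lines N S. \<exists>i. \<forall>a\<in>S. c (inst w a) = i))"

lemma finite_words: "finite S \<Longrightarrow> finite (words N S)"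
  unfolding words_def by (rule finite_lists_length_eq)

lemma inst_in_words: "w \<in> words N (insert None (Some ` S)) \<Longrightarrow> a \<in> S \<Longrightarrow> inst w a \<in> words N S"
  by (fastforce simp: words_def inst_def split: option.splits)

lemma inst_append: "inst (v @ w) a = inst v a @ inst w a"
  by (simp add: inst_def)

lemma inst_map_Some: "inst (map Some u) a = u"
  by (simp add: inst_def comp_def)

lemma append_in_words: "u \<in> words M S \<Longrightarrow> v \<in> words N S \<Longrightarrow> u @ v \<in> words (M + N) S"
  by (auto simp: words_def)

lemma map_Some_in_words: "u \<in> words N S \<Longrightarrow> map Some u \<in> words N (insert None (Some ` S))"
  by (auto simp: words_def)

lemma lines_mono: "S \<subseteq> S' \<Longrightarrow> lines N S \<subseteq> lines N S'"
  by (auto simp: words_def lines_def)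

lemma lines_words: "w \<in> lines N S \<Longrightarrow> w \<in> words N (insert None (Some ` S))"
  by (simp add: lines_def)

lemma append_in_lines:
  assumes "v \<in> words M (insert None (Some ` S))" "w \<in> words N (insert None (Some ` S))"
    and "None \<in> set v \<or> None \<in> set w"
  shows "v @ w \<in> lines (M + N) S"
  using assms by (auto simp: words_def lines_def)

text \<open>The colors may be arbitrary objects, since color focusing uses functions on words as
  colors. A numbering of \<open>C\<close> reduces this to numerical colors, and its injectivity
  brings equality of colors back.\<close>

lemma hales_jewett_finite_range:
  assumes "hales_jewett S k N" "c \<in> words N S \<rightarrow> C" "finite C" "card C \<le> k"
  shows "\<exists>w\<in>lines N S. \<exists>i. \<forall>a\<in>S. c (inst w a) = i"
proof -
  obtain h where h: "inj_on h C" "h ` C = {..<card C}"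
    using ex_bij_betw_finite_nat[OF assms(3)] by (auto simp: bij_betw_def atLeast0LessThan)
  have "h \<circ> c \<in> words N S \<rightarrow> {..<k}"
  proof
    fix u assume "u \<in> words N S"
    then have "h (c u) \<in> {..<card C}" using assms(2) h(2) by blast
    then show "(h \<circ> c) u \<in> {..<k}" using assms(4) by simp
  qed
  then obtain w i where w: "w \<in> lines N S" "\<forall>a\<in>S. h (c (inst w a)) = i"
    using assms(1) unfolding hales_jewett_def comp_def by blast
  have "c (inst w a) = c (inst w b)" if "a \<in> S" "b \<in> S" for a b
  proof (rule inj_onD[OF h(1)])
    show "h (c (inst w a)) = h (c (inst w b))" using w(2) that by simp
    show "c (inst w a) \<in> C" "c (inst w b) \<in> C"
      using assms(2) that inst_in_words[OF lines_words[OF w(1)]] by blast+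
  qed
  \<comment> \<open>The choice operator names the common color also when \<open>S\<close> is empty
    and the claim is vacuous.\<close>
  then have "\<forall>a\<in>S. c (inst w a) = c (inst w (SOME b. b \<in> S))"
    by (metis someI)
  then show ?thesis
    using w(1) by blast
qed

section \<open>Color focusing\<close>

definition mono_line :: "('l list \<Rightarrow> nat) \<Rightarrow> nat \<Rightarrow> 'l set \<Rightarrow> bool" where
  "mono_line c N S \<longleftrightarrow> (\<exists>w\<in>lines N S. \<exists>i. \<forall>a\<in>S. c (inst w a) = i)"

text \<open>The lines are indexed by their own colors on the letters of \<open>A\<close>, so
  different lines of the family have different colors. All of them pass through the focus
  \<open>f\<close> at the letter \<open>z\<close>.\<close>

definition focused :: "('l list \<Rightarrow> nat) \<Rightarrow> nat \<Rightarrow> 'l set \<Rightarrow> 'l \<Rightarrow> nat \<Rightarrow> nat set \<Rightarrow> 'l list \<Rightarrow>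
    (nat \<Rightarrow> 'l option list) \<Rightarrow> bool" where
  "focused c N A z k I f g \<longleftrightarrow> I \<subseteq> {..<k} \<and> f \<in> words N (insert z A) \<and>
     (\<forall>i\<in>I. g i \<in> lines N (insert z A) \<and> inst (g i) z = f \<and> (\<forall>a\<in>A. c (inst (g i) a) = i))"

lemma focused_mono_line:
  assumes "focused c N A z k I f g" "c f \<in> I"
  shows "mono_line c N (insert z A)"
proof -
  have "g (c f) \<in> lines N (insert z A)" "\<forall>a\<in>insert z A. c (inst (g (c f)) a) = c f"
    using assms by (auto simp: focused_def)
  then show ?thesis unfolding mono_line_def by blast
qed

text \<open>Induction on the number \<open>r\<close> of lines. Words are split into a prefix of
  length \<open>M\<close> and a suffix of length \<open>N\<close>, and a suffix is colored by the
  coloring it induces on all prefixes. The Hales-Jewett theorem for \<open>A\<close> gives a suffix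
  line \<open>w0\<close> on which this induced coloring is constant, and the induction hypothesis is
  applied to that coloring.\<close>

lemma color_focusing:
  assumes A: "A \<noteq> {}" and fin: "finite (insert z A)" and IH: "\<And>k. \<exists>N. hales_jewett A k N"
  shows "\<exists>N. \<forall>c. c \<in> words N (insert z A) \<rightarrow> {..<k} \<longrightarrow>
     mono_line c N (insert z A) \<or> (\<exists>I f g. card I = r \<and> focused c N A z k I f g)"
proof (induction r)
  case 0
  have "focused c 0 A z k {} [] (\<lambda>_. [])" for c
    by (simp add: words_def focused_def)
  then show ?case by (metis card.empty)
next
  case (Suc r)
  let ?S = "insert z A"
  obtain M where M: "\<And>c. c \<in> words M ?S \<rightarrow> {..<k} \<Longrightarrow>
     mono_line c M ?S \<or> (\<exists>I f g. card I = r \<and> focused c M A z k I f g)"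
    using Suc.IH by blast
  let ?C = "words M ?S \<rightarrow>\<^sub>E {..<k}"
  have finC: "finite ?C"
    by (intro finite_PiE finite_words fin) auto
  obtain N where N: "hales_jewett A (card ?C) N"
    using IH by blast
  obtain a0 where a0: "a0 \<in> A"
    using A by blast
  show ?case
  proof (intro exI[of _ "M + N"] allI impI)
    fix c assume c: "c \<in> words (M + N) ?S \<rightarrow> {..<k}"
    let ?d = "\<lambda>v. restrict (\<lambda>u. c (u @ v)) (words M ?S)"
    have sub: "words N A \<subseteq> words N ?S"
      by (auto simp: words_def)
    have "?d \<in> words N A \<rightarrow> ?C"
      using c append_in_words sub by (fastforce simp: PiE_iff)
    then obtain w0 i0 where w0: "w0 \<in> lines N A" "\<forall>a\<in>A. ?d (inst w0 a) = i0"
      using hales_jewett_finite_range[OF N _ finC] by blast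
    have w0S: "w0 \<in> lines N ?S" "w0 \<in> words N (insert None (Some ` ?S))" "None \<in> set w0"
      using w0(1) lines_mono[of A ?S N] by (auto simp: lines_def)
    \<comment> \<open>Any letter of \<open>A\<close> gives the same \<open>c'\<close>. The word
      \<open>inst w0 z\<close> is not covered: there the induced coloring may differ.\<close>
    define c' where "c' u = c (u @ inst w0 a0)" for u
    have c': "c (u @ inst w0 a) = c' u" if "u \<in> words M ?S" "a \<in> A" for u a
    proof -
      have "?d (inst w0 a) = ?d (inst w0 a0)"
        using w0(2) that(2) a0 by simp
      then have "?d (inst w0 a) u = ?d (inst w0 a0) u"
        by (rule fun_cong)
      then show ?thesis
        using that(1) by (simp add: c'_def)
    qed
    have c'k: "c' \<in> words M ?S \<rightarrow> {..<k}"
      using c append_in_words[OF _ inst_in_words[OF w0S(2)]] a0 by (auto simp: c'_def Pi_iff)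
    have words0: "map Some (inst w0 a) \<in> words N (insert None (Some ` ?S))" if "a \<in> ?S" for a
      using that inst_in_words[OF w0S(2)] map_Some_in_words by blast
    \<comment> \<open>Freezing the suffix at \<open>inst w0 a0\<close> turns a line for
      \<open>c'\<close> into a line for \<open>c\<close> with the same colors.\<close>
    have mono_lift: "mono_line c (M + N) ?S" if mono: "mono_line c' M ?S"
    proof -
      obtain w i where w: "w \<in> lines M ?S" "\<forall>a\<in>?S. c' (inst w a) = i"
        using mono by (auto simp: mono_line_def)
      have "w @ map Some (inst w0 a0) \<in> lines (M + N) ?S"
        using w(1) words0 a0 by (intro append_in_lines) (auto simp: lines_def)
      moreover have "\<forall>a\<in>?S. c (inst (w @ map Some (inst w0 a0)) a) = i"
        using w(2) by (auto simp: inst_append inst_map_Some c'_def)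
      ultimately show ?thesis unfolding mono_line_def by blast
    qed
    show "mono_line c (M + N) ?S \<or> (\<exists>I f g. card I = Suc r \<and> focused c (M + N) A z k I f g)"
    proof (cases "mono_line c' M ?S")
      case True
      then show ?thesis using mono_lift by blast
    next
      case no_mono: False
      then obtain I f g where card: "card I = r" and foc: "focused c' M A z k I f g"
        using M[OF c'k] by blast
      have f: "f \<in> words M ?S" and "finite I"
        using foc finite_subset[of I "{..<k}"] by (auto simp: focused_def)
      \<comment> \<open>A focus whose color already occurs in \<open>I\<close> would complete a
        monochromatic line, so the line added next has a fresh color.\<close>
      have new: "c' f \<notin> I"
        using no_mono focused_mono_line[OF foc] by blast
      \<comment> \<open>In the old lines prefix and suffix move together. The new line keeps the
        prefix \<open>f\<close> fixed and moves only along \<open>w0\<close>, so its color is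
        \<open>c' f\<close>. At \<open>z\<close> all of them reach
        \<open>f @ inst w0 z\<close>.\<close>
      define g' where "g' i = (if i \<in> I then g i @ w0 else map Some f @ w0)" for i
      have "g' i \<in> lines (M + N) ?S \<and> inst (g' i) z = f @ inst w0 z \<and>
          (\<forall>a\<in>A. c (inst (g' i) a) = i)" if i: "i \<in> insert (c' f) I" for i
      proof (cases "i \<in> I")
        case True
        then have gi: "g i \<in> lines M ?S" "inst (g i) z = f" "\<And>a. a \<in> A \<Longrightarrow> c' (inst (g i) a) = i"
          using foc by (auto simp: focused_def)
        have "g i @ w0 \<in> lines (M + N) ?S"
          using lines_words[OF gi(1)] w0S by (intro append_in_lines) auto
        moreover have "c (inst (g i @ w0) a) = i" if "a \<in> A" for a
          using gi(3) c'[OF inst_in_words[OF lines_words[OF gi(1)]]] that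
          by (simp add: inst_append)
        ultimately show ?thesis
          using gi(2) True by (simp add: g'_def inst_append)
      next
        case False
        then have "i = c' f" using i by simp
        have "map Some f @ w0 \<in> lines (M + N) ?S"
          using map_Some_in_words[OF f] w0S by (intro append_in_lines) auto
        then show ?thesis
          using False c'[OF f] \<open>i = c' f\<close> by (simp add: g'_def inst_append inst_map_Some)
      qed
      moreover have "c' f < k" using c'k f by blast
      moreover have "f @ inst w0 z \<in> words (M + N) ?S"
        using f inst_in_words[OF w0S(2)] by (intro append_in_words) auto
      ultimately have "focused c (M + N) A z k (insert (c' f) I) (f @ inst w0 z) g'"
        using foc unfolding focused_def by simp
      moreover have "card (insert (c' f) I) = Suc r"
        using new card \<open>finite I\<close> by simp
      ultimately show ?thesis by blast
    qed
  qed
qed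

text \<open>Induction on the alphabet. Once \<open>k\<close> lines with distinct colors are focused,
  all \<open>k\<close> colors are used up, so the focus shares its color with one of the lines, and
  that line is monochromatic at \<open>z\<close> as well.\<close>

theorem hales_jewett:
  assumes "finite S" "S \<noteq> {}"
  shows "\<exists>N. hales_jewett S k N"
  using assms
proof (induction S arbitrary: k rule: finite_ne_induct)
  case (singleton x)
  have "[None] \<in> lines 1 {x}"
    by (simp add: lines_def words_def)
  then show ?case
    unfolding hales_jewett_def by blast
next
  case (insert z A)
  let ?S = "insert z A"
  obtain N where N: "\<And>c. c \<in> words N ?S \<rightarrow> {..<k} \<Longrightarrow>
     mono_line c N ?S \<or> (\<exists>I f g. card I = k \<and> focused c N A z k I f g)"
    using color_focusing[of A z k k] insert by auto
  have "mono_line c N ?S" if c: "c \<in> words N ?S \<rightarrow> {..<k}" for c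
    using N[OF c]
  proof (elim disjE exE conjE)
    fix I f g
    assume I: "card I = k" and foc: "focused c N A z k I f g"
    have "I = {..<k}"
      using I foc by (intro card_subset_eq) (auto simp: focused_def)
    moreover have "c f < k"
      using c foc by (auto simp: focused_def)
    ultimately show ?thesis using focused_mono_line[OF foc] by blast
  qed
  then show ?case unfolding hales_jewett_def mono_line_def by blast
qed

subsection \<open>The partite construction\<close>

text \<open>The fibres of \<open>\<pi>\<close> are the parts. A pair \<open>(M, R)\<close>
  prescribes which parts are met, each exactly once, and which of them are joined.\<close>

definition transversal :: "('v \<Rightarrow> 'i) \<Rightarrow> ('v \<Rightarrow> 'v \<Rightarrow> bool) \<Rightarrow> 'i set \<Rightarrow> ('i \<times> 'i) set \<Rightarrow> 'v set \<Rightarrow> bool" where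
  "transversal \<pi> E M R T \<longleftrightarrow>
     bij_betw \<pi> T M \<and> (\<forall>x\<in>T. \<forall>y\<in>T. E x y \<longleftrightarrow> (\<pi> x, \<pi> y) \<in> R)"

text \<open>Since parts are preserved, such a map is injective on every transversal.\<close>

definition partite_embedding :: "('v \<Rightarrow> 'w) \<Rightarrow> 'v set \<Rightarrow> ('v \<Rightarrow> 'i) \<Rightarrow> ('v \<Rightarrow> 'v \<Rightarrow> bool) \<Rightarrow>
    'w set \<Rightarrow> ('w \<Rightarrow> 'i) \<Rightarrow> ('w \<Rightarrow> 'w \<Rightarrow> bool) \<Rightarrow> bool" where
  "partite_embedding f V \<pi> E V' \<pi>' E' \<longleftrightarrow>
     f \<in> V \<rightarrow> V' \<and> (\<forall>x\<in>V. \<pi>' (f x) = \<pi> x) \<and> (\<forall>x\<in>V. \<forall>y\<in>V. E' (f x) (f y) \<longleftrightarrow> E x y)"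

lemma partite_embedding_id: "partite_embedding (\<lambda>x. x) V \<pi> E V \<pi> E"
  by (simp add: partite_embedding_def)

lemma partite_embedding_comp:
  "partite_embedding f V \<pi> E V' \<pi>' E' \<Longrightarrow> partite_embedding g V' \<pi>' E' V'' \<pi>'' E'' \<Longrightarrow>
   partite_embedding (g \<circ> f) V \<pi> E V'' \<pi>'' E''"
  by (auto simp: partite_embedding_def Pi_iff)

lemma transversal_image:
  assumes f: "partite_embedding f V \<pi> E V' \<pi>' E'" and T: "T \<subseteq> V" "transversal \<pi> E M R T"
  shows "transversal \<pi>' E' M R (f ` T)"
proof -
  have pi: "\<pi>' (f x) = \<pi> x" if "x \<in> T" for x
    using f T that by (auto simp: partite_embedding_def)
  then have "bij_betw \<pi>' (f ` T) M"
    using T(2) by (auto simp: transversal_def bij_betw_def inj_on_def image_image)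
  moreover have "E' (f x) (f y) \<longleftrightarrow> (\<pi>' (f x), \<pi>' (f y)) \<in> R" if "x \<in> T" "y \<in> T" for x y
  proof -
    have "E' (f x) (f y) \<longleftrightarrow> E x y"
      using f T(1) that unfolding partite_embedding_def by blast
    then show ?thesis
      using T(2) that by (simp add: pi transversal_def)
  qed
  ultimately show ?thesis
    unfolding transversal_def by blast
qed

text \<open>A transversal is encoded by the function that selects its vertex in each part. These
  functions are the letters to which the Hales-Jewett theorem is applied.\<close>

definition sections :: "'v set \<Rightarrow> ('v \<Rightarrow> 'i) \<Rightarrow> ('v \<Rightarrow> 'v \<Rightarrow> bool) \<Rightarrow> 'i set \<Rightarrow> ('i \<times> 'i) set \<Rightarrow> ('i \<Rightarrow> 'v) set" where
  "sections V \<pi> E M R =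
     {s \<in> M \<rightarrow>\<^sub>E V. (\<forall>i\<in>M. \<pi> (s i) = i) \<and> (\<forall>i\<in>M. \<forall>j\<in>M. E (s i) (s j) \<longleftrightarrow> (i, j) \<in> R)}"

lemma finite_sections: "finite M \<Longrightarrow> finite V \<Longrightarrow> finite (sections V \<pi> E M R)"
  unfolding sections_def by (rule finite_subset[of _ "M \<rightarrow>\<^sub>E V"]) (auto intro: finite_PiE)

lemma transversal_section:
  assumes "T \<subseteq> V" "transversal \<pi> E M R T"
  obtains s where "s \<in> sections V \<pi> E M R" "s ` M = T"
proof
  let ?s = "restrict (the_inv_into T \<pi>) M"
  have bij: "bij_betw \<pi> T M" and inv: "\<And>i. i \<in> M \<Longrightarrow> the_inv_into T \<pi> i \<in> T"
    using assms(2) bij_betw_the_inv_into bij_betwE unfolding transversal_def by blast+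
  have pi: "\<pi> (the_inv_into T \<pi> i) = i" if "i \<in> M" for i
    using that bij f_the_inv_into_f_bij_betw by fastforce
  show "?s ` M = T"
    using bij_betw_the_inv_into[OF bij] by (simp add: bij_betw_def)
  show "?s \<in> sections V \<pi> E M R"
    unfolding sections_def
  proof (intro CollectI conjI ballI)
    show "?s \<in> M \<rightarrow>\<^sub>E V" using inv assms(1) by auto
  next
    fix i j assume "i \<in> M" "j \<in> M"
    then show "E (?s i) (?s j) \<longleftrightarrow> (i, j) \<in> R"
      using assms(2) inv pi by (simp add: transversal_def)
  qed (simp add: pi)
qed

text \<open>Coordinatewise power of a partite graph over the words of length \<open>N\<close>. The letter
  \<^const>\<open>None\<close> pads the parts outside \<open>M\<close>. On a combinatorial line the fixed coordinates of two
  vertices are adjacent iff \<open>R\<close> relates their parts, so the quantifier chosen by \<open>R\<close> makes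
  adjacency in the power depend on the moving coordinates only.\<close>

definition power_adj :: "(nat \<Rightarrow> nat \<Rightarrow> bool) \<Rightarrow> ('i::countable \<times> 'i) set \<Rightarrow> nat \<Rightarrow> nat \<Rightarrow> nat \<Rightarrow> bool" where
  "power_adj E R N x y \<longleftrightarrow>
     (let (i, u) = from_nat x :: 'i \<times> nat option list; (j, v) = from_nat y;
          adj = (\<lambda>m. \<exists>a b. u ! m = Some a \<and> v ! m = Some b \<and> E a b)
      in if (i, j) \<in> R then \<forall>m<N. adj m else \<exists>m<N. adj m)"

text \<open>One coordinate of the image of \<open>x\<close> under the embedding defined by a line: a
  moving coordinate keeps \<open>x\<close>, a fixed one substitutes the vertex that the section
  selects in the part of \<open>x\<close>.\<close>

definition coord :: "(nat \<Rightarrow> 'i) \<Rightarrow> 'i set \<Rightarrow> nat \<Rightarrow> ('i \<Rightarrow> nat) option \<Rightarrow> nat option" where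
  "coord \<pi> M x l = (case l of None \<Rightarrow> Some x | Some s \<Rightarrow> if \<pi> x \<in> M then Some (s (\<pi> x)) else None)"

lemma power_adj_line:
  assumes R: "R \<subseteq> M \<times> M" and w: "w \<in> lines N (sections V \<pi> E M R)"
  shows "power_adj E R N (to_nat (\<pi> x, map (coord \<pi> M x) w)) (to_nat (\<pi> y, map (coord \<pi> M y) w))
      \<longleftrightarrow> E x y"
proof -
  define adj where
    "adj m \<longleftrightarrow> (\<exists>a b. coord \<pi> M x (w ! m) = Some a \<and> coord \<pi> M y (w ! m) = Some b \<and> E a b)" for m
  have len: "length w = N" and sets: "set w \<subseteq> insert None (Some ` sections V \<pi> E M R)"
    and "None \<in> set w"
    using w by (auto simp: lines_def words_def)
  then obtain m0 where m0: "m0 < N" "w ! m0 = None"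
    by (metis in_set_conv_nth)
  \<comment> \<open>If one of the two parts lies outside \<open>M\<close>, both sides are false at a
    fixed coordinate: its entry is \<open>None\<close>, and \<open>R\<close> is contained in
    \<open>M \<times> M\<close>.\<close>
  have adj: "adj m \<longleftrightarrow> (if w ! m = None then E x y else (\<pi> x, \<pi> y) \<in> R)" if "m < N" for m
  proof (cases "w ! m")
    case None
    then show ?thesis by (simp add: adj_def coord_def)
  next
    case (Some s)
    then have "s \<in> sections V \<pi> E M R"
      using sets len that nth_mem by fastforce
    then show ?thesis
      using R Some by (auto simp: adj_def coord_def sections_def)
  qed
  have "power_adj E R N (to_nat (\<pi> x, map (coord \<pi> M x) w)) (to_nat (\<pi> y, map (coord \<pi> M y) w))
      \<longleftrightarrow> (if (\<pi> x, \<pi> y) \<in> R then \<forall>m<N. adj m else \<exists>m<N. adj m)"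
    using len by (simp add: power_adj_def adj_def Let_def cong: conj_cong)
  also have "\<dots> \<longleftrightarrow> E x y"
    using m0 adj by (cases "(\<pi> x, \<pi> y) \<in> R") (simp, metis)+
  finally show ?thesis .
qed

text \<open>A line over the alphabet of sections embeds the partite graph into its power, and the
  transversal of a section \<open>s\<close> is sent to the point of the line at \<open>s\<close>. A
  monochromatic line therefore gives all transversals the same value.\<close>

lemma partite_step:
  fixes \<pi> :: "nat \<Rightarrow> 'i::countable"
  assumes V: "finite V" and R: "R \<subseteq> M \<times> M"
  shows "\<exists>(V' :: nat set) \<pi>' E'. finite V' \<and> (\<forall>\<alpha>. (\<forall>T. \<alpha> T < k) \<longrightarrow>
     (\<exists>f i. partite_embedding f V \<pi> E V' \<pi>' E' \<and> (\<forall>T\<subseteq>V. transversal \<pi> E M R T \<longrightarrow> \<alpha> (f ` T) = (i::nat))))"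
proof (cases "\<exists>T\<subseteq>V. transversal \<pi> E M R T")
  \<comment> \<open>Without transversals the alphabet would be empty; the identity embedding then
    satisfies the claim vacuously.\<close>
  case False
  then have triv: "\<exists>f i. partite_embedding f V \<pi> E V \<pi> E \<and>
      (\<forall>T\<subseteq>V. transversal \<pi> E M R T \<longrightarrow> \<alpha> (f ` T) = i)" for \<alpha> :: "nat set \<Rightarrow> nat"
    using partite_embedding_id by blast
  show ?thesis
    by (intro exI[of _ V] exI[of _ \<pi>] exI[of _ E] conjI allI impI V triv)
next
  case True
  let ?S = "sections V \<pi> E M R"
  obtain T where T: "T \<subseteq> V" "transversal \<pi> E M R T"
    using True by blast
  have "finite M"
    using T V finite_subset by (auto simp: transversal_def bij_betw_def)
  then have "finite ?S" "?S \<noteq> {}"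
    using V finite_sections transversal_section[OF T] by (blast, fastforce)
  then obtain N where N: "hales_jewett ?S k N"
    using hales_jewett by blast
  \<comment> \<open>Pairs of a part and a word are coded as natural numbers, so the new vertex set
    has the old type and the step can be iterated.\<close>
  define V' where "V' = (to_nat ` (\<pi> ` V \<times> words N (insert None (Some ` V))) :: nat set)"
  define \<pi>' where "\<pi>' x = fst (from_nat x :: 'i \<times> nat option list)" for x
  have hom: "\<exists>f i. partite_embedding f V \<pi> E V' \<pi>' (power_adj E R N) \<and>
      (\<forall>T\<subseteq>V. transversal \<pi> E M R T \<longrightarrow> \<alpha> (f ` T) = i)" if \<alpha>: "\<forall>T. \<alpha> T < k" for \<alpha>
  proof -
    \<comment> \<open>A word of sections is evaluated coordinatewise at each part of
      \<open>M\<close>, which gives a set with one vertex in each of these parts; its value under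
      \<open>\<alpha>\<close> colors the word.\<close>
    define c where "c u = \<alpha> ((\<lambda>i. to_nat (i, map (\<lambda>s. Some (s i)) u)) ` M)" for u :: "('i \<Rightarrow> nat) list"
    have "c \<in> words N ?S \<rightarrow> {..<k}"
      using \<alpha> by (simp add: c_def)
    then obtain w i where w: "w \<in> lines N ?S" and i: "\<And>s. s \<in> ?S \<Longrightarrow> c (inst w s) = i"
      using N unfolding hales_jewett_def by blast
    define f where "f x = to_nat (\<pi> x, map (coord \<pi> M x) w)" for x
    have "coord \<pi> M x l \<in> insert None (Some ` V)" if "x \<in> V" "l \<in> set w" for x l
    proof (cases l)
      case (Some s)
      then have "s \<in> ?S"
        using that(2) w by (auto simp: lines_def words_def)
      then show ?thesis
        using Some by (auto simp: coord_def sections_def)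
    qed (use that(1) in \<open>simp add: coord_def\<close>)
    then have "map (coord \<pi> M x) w \<in> words N (insert None (Some ` V))" if "x \<in> V" for x
      using that w by (auto simp: lines_def words_def)
    then have "f x \<in> V'" if "x \<in> V" for x
      using that by (simp add: f_def V'_def)
    then have emb: "partite_embedding f V \<pi> E V' \<pi>' (power_adj E R N)"
      using power_adj_line[OF R w] by (simp add: partite_embedding_def f_def \<pi>'_def)
    have "\<alpha> (f ` T) = i" if T: "T \<subseteq> V" "transversal \<pi> E M R T" for T
    proof -
      obtain s where s: "s \<in> ?S" "s ` M = T"
        using transversal_section[OF T] .
      \<comment> \<open>On the vertices \<open>s j\<close> a moving coordinate contributes
        \<open>s j\<close>, exactly as if the letter \<open>s\<close> had been substituted
        there.\<close>
      have "f (s j) = to_nat (j, map (\<lambda>s. Some (s j)) (inst w s))" if "j \<in> M" for j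
        using s(1) that by (auto simp: f_def inst_def coord_def sections_def split: option.splits)
      then have "f ` T = (\<lambda>i. to_nat (i, map (\<lambda>s. Some (s i)) (inst w s))) ` M"
        using s(2) by (auto simp: image_iff)
      then show ?thesis
        using i[OF s(1)] by (simp add: c_def)
    qed
    then show ?thesis using emb by blast
  qed
  have fin: "finite V'"
    unfolding V'_def by (intro finite_imageI finite_cartesian_product finite_words finite.insertI V)
  show ?thesis
    by (intro exI[of _ V'] exI[of _ \<pi>'] exI[of _ "power_adj E R N"] conjI allI impI fin hom) simp
qed

text \<open>The prescriptions are treated one at a time. Enlarging the graph for a new one keeps the
  earlier ones, because the coloring is first made constant on the new type in the larger graph and
  only then pulled back to the smaller one.\<close>

theorem partite_construction:
  fixes \<pi> :: "nat \<Rightarrow> 'i::countable" and \<T> :: "('i set \<times> ('i \<times> 'i) set) set"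
  assumes "finite \<T>" "finite V" "\<forall>(M, R)\<in>\<T>. R \<subseteq> M \<times> M"
  shows "\<exists>(V' :: nat set) \<pi>' E'. finite V' \<and> (\<forall>\<alpha>. (\<forall>T. \<alpha> T < k) \<longrightarrow>
     (\<exists>f. partite_embedding f V \<pi> E V' \<pi>' E' \<and>
        (\<forall>(M, R)\<in>\<T>. \<exists>i::nat. \<forall>T\<subseteq>V. transversal \<pi> E M R T \<longrightarrow> \<alpha> (f ` T) = i)))"
  using assms
proof (induction \<T> rule: finite_induct)
  case empty
  have triv: "\<exists>f. partite_embedding f V \<pi> E V \<pi> E \<and>
      (\<forall>(M, R)\<in>{}. \<exists>i::nat. \<forall>T\<subseteq>V. transversal \<pi> E M R T \<longrightarrow> \<alpha> (f ` T) = i)"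
    for \<alpha> :: "nat set \<Rightarrow> nat"
    using partite_embedding_id by blast
  show ?case
    by (intro exI[of _ V] exI[of _ \<pi>] exI[of _ E] conjI allI impI \<open>finite V\<close> triv)
next
  case (insert t \<T>)
  obtain M R where t: "t = (M, R)" by fastforce
  have R: "R \<subseteq> M \<times> M" using insert.prems t by blast
  have "\<forall>(M, R)\<in>\<T>. R \<subseteq> M \<times> M"
    using insert.prems(2) by blast
  note IH = insert.IH[OF \<open>finite V\<close> this]
  obtain V1 :: "nat set" and \<pi>1 E1 where V1: "finite V1" and hom1: "\<forall>\<alpha>. (\<forall>T. \<alpha> T < k) \<longrightarrow>
     (\<exists>f. partite_embedding f V \<pi> E V1 \<pi>1 E1 \<and>
        (\<forall>(M, R)\<in>\<T>. \<exists>i::nat. \<forall>T\<subseteq>V. transversal \<pi> E M R T \<longrightarrow> \<alpha> (f ` T) = i))"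
    using IH by (elim exE conjE) (rule that)
  obtain V2 :: "nat set" and \<pi>2 E2 where V2: "finite V2" and hom2: "\<forall>\<alpha>. (\<forall>T. \<alpha> T < k) \<longrightarrow>
     (\<exists>f i. partite_embedding f V1 \<pi>1 E1 V2 \<pi>2 E2 \<and>
        (\<forall>T\<subseteq>V1. transversal \<pi>1 E1 M R T \<longrightarrow> \<alpha> (f ` T) = (i::nat)))"
    using partite_step[OF V1 R, of k \<pi>1 E1] by (elim exE conjE) (rule that)
  have hom: "\<exists>f. partite_embedding f V \<pi> E V2 \<pi>2 E2 \<and>
        (\<forall>(M, R)\<in>insert t \<T>. \<exists>i::nat. \<forall>T\<subseteq>V. transversal \<pi> E M R T \<longrightarrow> \<alpha> (f ` T) = i)"
    if \<alpha>: "\<forall>T. \<alpha> T < k" for \<alpha>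
  proof -
    obtain g i where g: "partite_embedding g V1 \<pi>1 E1 V2 \<pi>2 E2"
      and i: "\<And>T. T \<subseteq> V1 \<Longrightarrow> transversal \<pi>1 E1 M R T \<Longrightarrow> \<alpha> (g ` T) = i"
      using hom2 \<alpha> by blast
    obtain f where f: "partite_embedding f V \<pi> E V1 \<pi>1 E1"
      and hom_f: "\<forall>(M, R)\<in>\<T>. \<exists>i. \<forall>T\<subseteq>V. transversal \<pi> E M R T \<longrightarrow> \<alpha> (g ` f ` T) = i"
      using hom1[THEN spec, of "\<lambda>T. \<alpha> (g ` T)"] \<alpha> by blast
    have "\<alpha> (g ` f ` T) = i" if "T \<subseteq> V" "transversal \<pi> E M R T" for T
    proof (rule i)
      show "f ` T \<subseteq> V1" using f that(1) by (auto simp: partite_embedding_def)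
    qed (rule transversal_image[OF f that])
    then have "\<forall>(M, R)\<in>insert t \<T>. \<exists>i. \<forall>T\<subseteq>V. transversal \<pi> E M R T \<longrightarrow> \<alpha> ((g \<circ> f) ` T) = i"
      using hom_f t by (auto simp: image_comp)
    then show ?thesis using partite_embedding_comp[OF f g] by blast
  qed
  show ?case
    by (intro exI[of _ V2] exI[of _ \<pi>2] exI[of _ E2] conjI allI impI V2 hom) simp
qed

subsection \<open>Copies and colorings of finite ordered graphs\<close>

definition rank :: "('a, 'z) ograph_scheme \<Rightarrow> 'a \<Rightarrow> nat" where
  "rank G x = card {z. (z, x) \<in> lt G}"

lemma finite_ograph_lt:
  assumes "finite_ograph G"
  shows "finite {z. (z, x) \<in> lt G}" "(x, y) \<in> lt G \<Longrightarrow> x \<in> verts G \<and> y \<in> verts G"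
    "(x, y) \<in> lt G \<Longrightarrow> (y, z) \<in> lt G \<Longrightarrow> (x, z) \<in> lt G" "(x, x) \<notin> lt G"
    "x \<in> verts G \<Longrightarrow> y \<in> verts G \<Longrightarrow> x = y \<or> (x, y) \<in> lt G \<or> (y, x) \<in> lt G"
proof -
  show "finite {z. (z, x) \<in> lt G}"
    by (rule finite_subset[of _ "verts G"]) (use assms in \<open>auto simp: finite_ograph_def\<close>)
qed (use assms in \<open>auto simp: finite_ograph_def strict_linear_order_on_def irrefl_def total_on_def
      dest: transD\<close>)

lemma rank_mono:
  assumes "finite_ograph G" "(x, y) \<in> lt G"
  shows "rank G x < rank G y"
  unfolding rank_def
proof (rule psubset_card_mono)
  show "{z. (z, x) \<in> lt G} \<subset> {z. (z, y) \<in> lt G}"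
    using finite_ograph_lt(3,4)[OF assms(1)] assms(2) by blast
qed (rule finite_ograph_lt[OF assms(1)])

lemma rank_less_iff:
  assumes "finite_ograph G" "x \<in> verts G" "y \<in> verts G"
  shows "rank G x < rank G y \<longleftrightarrow> (x, y) \<in> lt G"
  using rank_mono[OF assms(1)] finite_ograph_lt(5)[OF assms] by (metis less_asym less_irrefl)

lemma inj_on_rank: "finite_ograph G \<Longrightarrow> inj_on (rank G) (verts G)"
  by (rule inj_onI) (metis finite_ograph_lt(5) rank_mono less_irrefl)

lemma bij_betw_rank:
  assumes G: "finite_ograph G"
  shows "bij_betw (rank G) (verts G) {..<card (verts G)}"
proof -
  have fin: "finite (verts G)" using G by (simp add: finite_ograph_def)
  have "rank G x < card (verts G)" if "x \<in> verts G" for x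
    unfolding rank_def
  proof (rule psubset_card_mono[OF fin])
    show "{z. (z, x) \<in> lt G} \<subset> verts G"
      using that finite_ograph_lt(2,4)[OF G] by blast
  qed
  then have "rank G ` verts G = {..<card (verts G)}"
    using inj_on_rank[OF G] by (intro card_subset_eq) (auto simp: card_image)
  then show ?thesis using inj_on_rank[OF G] by (simp add: bij_betw_def)
qed

lemma rank_iso:
  assumes f: "ograph_iso f A B" and A: "finite_ograph A" and B: "finite_ograph B" and x: "x \<in> verts A"
  shows "rank B (f x) = rank A x"
proof -
  have bij: "bij_betw f (verts A) (verts B)"
    and lt: "\<And>y z. y \<in> verts A \<Longrightarrow> z \<in> verts A \<Longrightarrow> (f y, f z) \<in> lt B \<longleftrightarrow> (y, z) \<in> lt A"
    using f by (auto simp: ograph_iso_def)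
  have "inj_on f {z. (z, x) \<in> lt A}"
    by (rule inj_on_subset[OF bij_betw_imp_inj_on[OF bij]]) (use finite_ograph_lt(2)[OF A] in blast)
  moreover have "f ` {z. (z, x) \<in> lt A} = {z. (z, f x) \<in> lt B}"
  proof (intro equalityI subsetI)
    fix z assume z: "z \<in> {z. (z, f x) \<in> lt B}"
    then have "z \<in> f ` verts A"
      using finite_ograph_lt(2)[OF B] bij by (auto simp: bij_betw_def)
    then show "z \<in> f ` {z. (z, x) \<in> lt A}"
      using z lt x by auto
  qed (use lt x finite_ograph_lt(2)[OF A] in auto)
  ultimately show ?thesis
    unfolding rank_def by (metis card_image)
qed

text \<open>Both maps preserve ranks, and a vertex of \<open>B\<close> is determined by its
  rank.\<close>

lemma ograph_iso_unique:
  assumes "ograph_iso f A B" "ograph_iso g A B" "finite_ograph A" "finite_ograph B" "x \<in> verts A"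
  shows "f x = g x"
proof (rule inj_onD[OF inj_on_rank[OF assms(4)]])
  show "rank B (f x) = rank B (g x)"
    using rank_iso assms by metis
  show "f x \<in> verts B" "g x \<in> verts B"
    using assms by (auto simp: ograph_iso_def dest: bij_betwE)
qed

section \<open>Embeddings and copies\<close>

definition embeds :: "('a \<Rightarrow> 'b) \<Rightarrow> 'a ograph \<Rightarrow> 'b ograph \<Rightarrow> bool" where
  "embeds f A B \<longleftrightarrow> f \<in> verts A \<rightarrow> verts B \<and>
     (\<forall>x\<in>verts A. \<forall>y\<in>verts A.
        ((f x, f y) \<in> edges B \<longleftrightarrow> (x, y) \<in> edges A) \<and> ((f x, f y) \<in> lt B \<longleftrightarrow> (x, y) \<in> lt A))"

lemma embeds_comp: "embeds f A B \<Longrightarrow> embeds g B C \<Longrightarrow> embeds (g \<circ> f) A C"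
  by (auto simp: embeds_def Pi_iff)

text \<open>Distinct vertices are comparable in \<open>A\<close>, so their images are comparable and
  hence distinct in the strict order of \<open>B\<close>.\<close>

lemma embeds_inj_on:
  assumes "embeds f A B" "finite_ograph A" "finite_ograph B"
  shows "inj_on f (verts A)"
proof (rule inj_onI)
  fix x y assume xy: "x \<in> verts A" "y \<in> verts A" "f x = f y"
  then have "(x, y) \<notin> lt A" "(y, x) \<notin> lt A"
    using assms(1) finite_ograph_lt(4)[OF assms(3)] unfolding embeds_def by metis+
  then show "x = y" using finite_ograph_lt(5)[OF assms(2)] xy by blast
qed

lemma embeds_iso:
  assumes "embeds f A B" "finite_ograph A" "finite_ograph B"
  shows "ograph_iso f A (induced B (f ` verts A))"
  using assms embeds_inj_on[OF assms] by (auto simp: ograph_iso_def embeds_def induced_def bij_betw_def)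

lemma finite_ograph_induced:
  assumes "finite_ograph G" "S \<subseteq> verts G"
  shows "finite_ograph (induced G S)"
proof -
  have "finite S" using assms finite_subset by (auto simp: finite_ograph_def)
  moreover have "trans (lt G \<inter> S \<times> S)"
    using finite_ograph_lt(3)[OF assms(1)] by (intro transI) blast
  moreover have "total_on S (lt G \<inter> S \<times> S)"
    using finite_ograph_lt(5)[OF assms(1)] assms(2) by (auto simp: total_on_def)
  ultimately show ?thesis
    using assms(1) by (auto simp: finite_ograph_def induced_def strict_linear_order_on_def
        irrefl_def sym_def)
qed

lemma induced_induced: "S' \<subseteq> S \<Longrightarrow> induced (induced G S) S' = induced G S'"
  by (auto simp: induced_def)

lemma copies_eq:
  assumes "finite_ograph A" "finite_ograph B"
  shows "copies A B = {induced B (f ` verts A) |f. embeds f A B}"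
proof (intro equalityI subsetI)
  fix C assume "C \<in> copies A B"
  then obtain S f where S: "S \<subseteq> verts B" "C = induced B S" and f: "ograph_iso f A C"
    by (auto simp: copies_def ograph_isomorphic_def)
  have "f ` verts A = S"
    using f S by (auto simp: ograph_iso_def bij_betw_def induced_def)
  moreover have "embeds f A B"
    unfolding embeds_def
  proof (intro conjI ballI)
    show "f \<in> verts A \<rightarrow> verts B" using \<open>f ` verts A = S\<close> S by auto
  qed (use f S \<open>f ` verts A = S\<close> in \<open>auto simp: ograph_iso_def induced_def\<close>)
  ultimately show "C \<in> {induced B (f ` verts A) |f. embeds f A B}"
    using S by blast
next
  fix C assume "C \<in> {induced B (f ` verts A) |f. embeds f A B}"
  then obtain f where f: "embeds f A B" "C = induced B (f ` verts A)" by blast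
  then have "f ` verts A \<subseteq> verts B" by (auto simp: embeds_def)
  then show "C \<in> copies A B"
    using f embeds_iso[OF f(1) assms] unfolding copies_def ograph_isomorphic_def by blast
qed

text \<open>Every embedding of \<open>X\<close> into the copy of \<open>Y\<close> factors through
  \<open>g\<close>, by composition with the inverse of \<open>g\<close> on its image.\<close>

lemma copies_copy:
  assumes fin: "finite_ograph X" "finite_ograph Y" "finite_ograph Z" and g: "embeds g Y Z"
  shows "copies X (induced Z (g ` verts Y)) = {induced Z ((g \<circ> f) ` verts X) |f. embeds f X Y}"
proof -
  let ?Y = "induced Z (g ` verts Y)"
  have sub: "g ` verts Y \<subseteq> verts Z" using g by (auto simp: embeds_def)
  have finY: "finite_ograph ?Y" using finite_ograph_induced[OF fin(3) sub] .
  have verts: "verts ?Y = g ` verts Y" by (simp add: induced_def)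
  have inj: "inj_on g (verts Y)" using embeds_inj_on[OF g fin(2,3)] .
  have g': "embeds g Y ?Y" using g by (auto simp: embeds_def induced_def)
  have ind: "induced ?Y ((g \<circ> f) ` verts X) = induced Z ((g \<circ> f) ` verts X)" if "embeds f X Y" for f
    by (rule induced_induced) (use that in \<open>auto simp: embeds_def\<close>)
  show ?thesis
  proof (intro equalityI subsetI)
    fix C assume "C \<in> copies X ?Y"
    then obtain u where u: "embeds u X ?Y" "C = induced ?Y (u ` verts X)"
      using copies_eq[OF fin(1) finY] by auto
    define f where "f = the_inv_into (verts Y) g \<circ> u"
    have uY: "u x \<in> g ` verts Y" if "x \<in> verts X" for x
      using u(1) verts that by (auto simp: embeds_def)
    have f: "f x \<in> verts Y" "g (f x) = u x" if "x \<in> verts X" for x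
      using the_inv_into_into[OF inj uY[OF that] subset_refl] f_the_inv_into_f[OF inj uY[OF that]]
      by (simp_all add: f_def)
    have "embeds f X Y"
      unfolding embeds_def
    proof (intro conjI ballI)
      fix x y assume xy: "x \<in> verts X" "y \<in> verts X"
      have "(g (f x), g (f y)) \<in> edges Z \<longleftrightarrow> (x, y) \<in> edges X"
        "(g (f x), g (f y)) \<in> lt Z \<longleftrightarrow> (x, y) \<in> lt X"
        using u(1) xy f uY unfolding embeds_def by (auto simp: induced_def)
      moreover have "(g (f x), g (f y)) \<in> edges Z \<longleftrightarrow> (f x, f y) \<in> edges Y"
        "(g (f x), g (f y)) \<in> lt Z \<longleftrightarrow> (f x, f y) \<in> lt Y"
        using g f(1) xy unfolding embeds_def by blast+
      ultimately show "(f x, f y) \<in> edges Y \<longleftrightarrow> (x, y) \<in> edges X" "(f x, f y) \<in> lt Y \<longleftrightarrow> (x, y) \<in> lt X"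
        by simp_all
    qed (use f in blast)
    moreover have "u ` verts X = (g \<circ> f) ` verts X" using f by auto
    ultimately show "C \<in> {induced Z ((g \<circ> f) ` verts X) |f. embeds f X Y}"
      using u(2) ind by auto
  next
    fix C assume "C \<in> {induced Z ((g \<circ> f) ` verts X) |f. embeds f X Y}"
    then obtain f where f: "embeds f X Y" "C = induced ?Y ((g \<circ> f) ` verts X)"
      using ind by auto
    then show "C \<in> copies X ?Y"
      using embeds_comp[OF f(1) g'] copies_eq[OF fin(1) finY] by blast
  qed
qed

section \<open>Proper colorings and their number\<close>

definition colorings :: "nat \<Rightarrow> ('a, 'z) ograph_scheme \<Rightarrow> ('a \<Rightarrow> nat) set" where
  "colorings n X = {c \<in> extensional (verts X). proper_coloring n X c}"

lemma finite_colorings: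
  assumes "finite_ograph X"
  shows "finite (colorings n X)"
proof (rule finite_subset)
  show "colorings n X \<subseteq> verts X \<rightarrow>\<^sub>E {1..n}"
    by (auto simp: colorings_def proper_coloring_def PiE_def)
  show "finite (verts X \<rightarrow>\<^sub>E {1..n})"
    using assms by (intro finite_PiE) (auto simp: finite_ograph_def)
qed

lemma proper_coloring_comp:
  assumes "proper_coloring n B c" "embeds f A B" "finite_ograph A"
  shows "restrict (c \<circ> f) (verts A) \<in> colorings n A"
proof -
  have "x \<in> verts A \<and> y \<in> verts A \<and> (f x, f y) \<in> edges B" if "(x, y) \<in> edges A" for x y
    using that assms(2,3) by (auto simp: embeds_def finite_ograph_def)
  then show ?thesis
    using assms(1,2) unfolding colorings_def proper_coloring_def embeds_def by fastforce
qed

text \<open>By rigidity the only automorphism of \<open>X\<close> is the identity, so isomorphic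
  extensions carry the same coloring and every isomorphism class is a singleton.\<close>

lemma sigma_eq_card_colorings:
  assumes X: "finite_ograph X"
  shows "sigma n X = card (colorings n X)"
proof -
  let ?ext = "\<lambda>c. \<lparr>verts = verts X, edges = edges X, lt = lt X, color = c\<rparr>"
  let ?r = "{(A, B). A \<in> extensions n X \<and> B \<in> extensions n X \<and> colored_isomorphic A B}"
  have ext: "extensions n X = ?ext ` colorings n X"
  proof (intro equalityI subsetI)
    fix A assume A: "A \<in> extensions n X"
    then have "A = ?ext (color A)" "color A \<in> colorings n X"
      by (cases A; auto simp: extensions_def colored_ographs_def colorings_def proper_coloring_def
          ograph.truncate_def)+
    then show "A \<in> ?ext ` colorings n X" by blast
  next
    fix A assume "A \<in> ?ext ` colorings n X"
    then show "A \<in> extensions n X"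
      using X by (auto simp: extensions_def colored_ographs_def colorings_def proper_coloring_def
          ograph.truncate_def finite_ograph_def)
  qed
  have "A = B" if AB: "A \<in> extensions n X" "B \<in> extensions n X" "colored_isomorphic A B" for A B
  proof -
    obtain c d where c: "A = ?ext c" "c \<in> colorings n X" and d: "B = ?ext d" "d \<in> colorings n X"
      using AB(1,2) ext by auto
    obtain f where f: "ograph_iso f A B" "\<forall>x\<in>verts A. color B (f x) = color A x"
      using AB(3) by (auto simp: colored_isomorphic_def)
    have "ograph_iso f X X"
      using f(1) c(1) d(1) by (simp add: ograph_iso_def)
    moreover have "ograph_iso (\<lambda>x. x) X X"
      by (simp add: ograph_iso_def bij_betw_def)
    ultimately have "d x = c x" if "x \<in> verts X" for x
      using that f(2) c(1) d(1) ograph_iso_unique[OF _ _ X X, of f "\<lambda>x. x" x] by auto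
    then have "c = d"
      using c(2) d(2) by (intro extensionalityI[of _ "verts X"]) (auto simp: colorings_def)
    then show "A = B" using c(1) d(1) by simp
  qed
  moreover have "colored_isomorphic A A" for A :: "'a colored_ograph"
    unfolding colored_isomorphic_def by (intro exI[of _ "\<lambda>x. x"]) (simp add: ograph_iso_def bij_betw_def)
  ultimately have "?r `` {A} = {A}" if "A \<in> extensions n X" for A
    using that by blast
  then have "extensions n X // ?r = (\<lambda>A. {A}) ` extensions n X"
    by (auto simp: quotient_def)
  then have "sigma n X = card (extensions n X)"
    unfolding sigma_def by (simp add: card_image)
  also have "\<dots> = card (colorings n X)"
    unfolding ext by (intro card_image inj_onI) simp
  finally show ?thesis .
qed

text \<open>Moves a graph built on an auxiliary type to \<open>'a\<close>, which is infinite and so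
  has room for any finite vertex set. The order is pulled back from the lexicographic order on
  pairs, and injectivity of \<open>key\<close> makes it total.\<close>

lemma realise_ograph:
  fixes W :: "'v set" and key :: "'v \<Rightarrow> nat \<times> nat"
  assumes W: "finite W" and key: "inj_on key W"
    and E: "\<And>x y. x \<in> W \<Longrightarrow> y \<in> W \<Longrightarrow> E x y \<Longrightarrow> E y x \<and> col x \<noteq> col y"
    and col: "\<And>x. x \<in> W \<Longrightarrow> col x \<in> {1..n}"
  obtains G :: "'a::infinite ograph" and h where "G \<in> colorable_ographs n" "bij_betw h W (verts G)"
    "\<And>x y. x \<in> W \<Longrightarrow> y \<in> W \<Longrightarrow> (h x, h y) \<in> edges G \<longleftrightarrow> E x y"
    "\<And>x y. x \<in> W \<Longrightarrow> y \<in> W \<Longrightarrow> (h x, h y) \<in> lt G \<longleftrightarrow> key x < key y"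
proof -
  obtain S :: "'a set" where "finite S" "card S = card W"
    using infinite_arbitrarily_large[OF infinite_UNIV] by blast
  then obtain h where h: "bij_betw h W S"
    using finite_same_card_bij[OF W] by metis
  then have inj: "inj_on h W" by (rule bij_betw_imp_inj_on)
  define G where "G = \<lparr>verts = S, edges = {(h x, h y) |x y. x \<in> W \<and> y \<in> W \<and> E x y},
      lt = {(h x, h y) |x y. x \<in> W \<and> y \<in> W \<and> key x < key y}\<rparr>"
  have edges: "(h x, h y) \<in> edges G \<longleftrightarrow> E x y" and lt: "(h x, h y) \<in> lt G \<longleftrightarrow> key x < key y"
    if "x \<in> W" "y \<in> W" for x y
    using that inj_on_eq_iff[OF inj] by (auto simp: G_def)
  have S: "S = h ` W" using h by (simp add: bij_betw_def)
  have "trans (lt G)"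
  proof (rule transI)
    fix a b c assume "(a, b) \<in> lt G" "(b, c) \<in> lt G"
    then obtain x y z where "x \<in> W" "y \<in> W" "z \<in> W" "a = h x" "b = h y" "c = h z"
      by (auto simp: G_def)
    then show "(a, c) \<in> lt G"
      using \<open>(a, b) \<in> lt G\<close> \<open>(b, c) \<in> lt G\<close> lt by (metis less_trans)
  qed
  moreover have "irrefl (lt G)"
    using inj_on_eq_iff[OF inj] by (auto simp: irrefl_def G_def)
  moreover have "total_on S (lt G)"
  proof (rule total_onI)
    fix a b assume "a \<in> S" "b \<in> S" "a \<noteq> b"
    then obtain x y where "x \<in> W" "y \<in> W" "a = h x" "b = h y" "x \<noteq> y"
      by (auto simp: S)
    then show "(a, b) \<in> lt G \<or> (b, a) \<in> lt G"
      using lt inj_on_eq_iff[OF key] by (metis linorder_neqE)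
  qed
  moreover have "irrefl (edges G)"
  proof (rule irreflI, rule notI)
    fix a assume "(a, a) \<in> edges G"
    then obtain x y where xy: "x \<in> W" "y \<in> W" "h x = h y" "E x y"
      by (auto simp: G_def)
    then show False
      using E[OF xy(1,2,4)] inj_on_eq_iff[OF inj] by auto
  qed
  moreover have "sym (edges G)"
  proof (rule symI)
    fix a b assume "(a, b) \<in> edges G"
    then obtain x y where xy: "x \<in> W" "y \<in> W" "a = h x" "b = h y" "E x y"
      by (auto simp: G_def)
    then show "(b, a) \<in> edges G"
      using E[OF xy(1,2,5)] by (auto simp: G_def)
  qed
  ultimately have "finite_ograph G"
    using \<open>finite S\<close> S by (auto simp: finite_ograph_def strict_linear_order_on_def G_def)
  moreover have "proper_coloring n G (col \<circ> the_inv_into W h)"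
    unfolding proper_coloring_def
  proof (intro conjI ballI)
    show "col \<circ> the_inv_into W h \<in> verts G \<rightarrow> {1..n}"
      using col S by (auto simp: G_def the_inv_into_f_f[OF inj])
  next
    fix e assume "e \<in> edges G"
    then obtain x y where xy: "x \<in> W" "y \<in> W" "e = (h x, h y)" "E x y"
      by (auto simp: G_def)
    then show "case e of (a, b) \<Rightarrow> (col \<circ> the_inv_into W h) a \<noteq> (col \<circ> the_inv_into W h) b"
      using E[OF xy(1,2,4)] by (simp add: the_inv_into_f_f[OF inj])
  qed
  ultimately have "G \<in> colorable_ographs n"
    by (auto simp: colorable_ographs_def)
  moreover have "bij_betw h W (verts G)"
    using h by (simp add: G_def)
  ultimately show ?thesis
    using that edges lt by blast
qed

subsection \<open>The lower bound\<close>

text \<open>\<open>Inl i\<close> is the clique vertex with index \<open>i\<close>, and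
  \<open>Inr (c, x)\<close> is the vertex \<open>x\<close> in the copy of \<open>X\<close> reserved
  for the coloring \<open>c\<close>.\<close>

fun forcing_adj :: "'a ograph \<Rightarrow> nat + ('a \<Rightarrow> nat) \<times> 'a \<Rightarrow> nat + ('a \<Rightarrow> nat) \<times> 'a \<Rightarrow> bool" where
  "forcing_adj X (Inl i) (Inl j) \<longleftrightarrow> i \<noteq> j"
| "forcing_adj X (Inl i) (Inr (c, x)) \<longleftrightarrow> i \<noteq> c x"
| "forcing_adj X (Inr (c, x)) (Inl i) \<longleftrightarrow> i \<noteq> c x"
| "forcing_adj X (Inr (c, x)) (Inr (c', y)) \<longleftrightarrow> c = c' \<and> (x, y) \<in> edges X"

fun forcing_color :: "nat + ('a \<Rightarrow> nat) \<times> 'a \<Rightarrow> nat" where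
  "forcing_color (Inl i) = i"
| "forcing_color (Inr (c, x)) = c x"

text \<open>If \<open>d\<close> permutes the colors of the clique by \<open>p\<close>, then the copy
  of \<open>X\<close> reserved for the coloring \<open>b\<close>, the composition of
  \<open>c\<close> with the inverse of \<open>p\<close>, is colored by \<open>c\<close>.\<close>

lemma color_forcing_graph:
  fixes X :: "'a::infinite ograph"
  assumes X: "finite_ograph X"
  obtains Y :: "'a ograph" where "Y \<in> colorable_ographs n"
    "\<And>d c. proper_coloring n Y d \<Longrightarrow> c \<in> colorings n X \<Longrightarrow>
      \<exists>f. embeds f X Y \<and> (\<forall>x\<in>verts X. d (f x) = c x)"
proof -
  let ?C = "colorings n X"
  define W where "W = Inl ` {1..n} \<union> Inr ` (?C \<times> verts X)"
  have finC: "finite ?C" using finite_colorings[OF X] .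
  obtain idx :: "('a \<Rightarrow> nat) \<Rightarrow> nat" where idx: "inj_on idx ?C"
    using finite_imp_inj_to_nat_seg[OF finC] by blast
  \<comment> \<open>The clique comes first, then the copies of \<open>X\<close> one after another,
    each ordered as \<open>X\<close> is.\<close>
  define key where "key v = (case v of Inl i \<Rightarrow> (0, i) | Inr (c, x) \<Rightarrow> (Suc (idx c), rank X x))"
    for v :: "nat + ('a \<Rightarrow> nat) \<times> 'a"
  have edgeX: "x \<in> verts X \<and> y \<in> verts X \<and> (y, x) \<in> edges X" if "(x, y) \<in> edges X" for x y
    using X that by (auto simp: finite_ograph_def dest: symD)
  have properC: "c x \<in> {1..n}" "(x, y) \<in> edges X \<Longrightarrow> c x \<noteq> c y" if "c \<in> ?C" "x \<in> verts X" for c x y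
    using that by (auto simp: colorings_def proper_coloring_def)
  have "finite W"
    using finC X by (auto simp: W_def finite_ograph_def)
  moreover have "inj_on key W"
    using inj_on_eq_iff[OF idx] inj_on_eq_iff[OF inj_on_rank[OF X]]
    by (auto simp: inj_on_def W_def key_def)
  moreover have "forcing_adj X v u \<and> forcing_color u \<noteq> forcing_color v"
    if "u \<in> W" "v \<in> W" "forcing_adj X u v" for u v
    using that edgeX properC by (auto simp: W_def)
  moreover have "forcing_color v \<in> {1..n}" if "v \<in> W" for v
    using that properC(1) by (auto simp: W_def)
  ultimately obtain Y :: "'a ograph" and h where Y: "Y \<in> colorable_ographs n"
    and h: "bij_betw h W (verts Y)"
    and edges: "\<And>u v. u \<in> W \<Longrightarrow> v \<in> W \<Longrightarrow> (h u, h v) \<in> edges Y \<longleftrightarrow> forcing_adj X u v"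
    and lt: "\<And>u v. u \<in> W \<Longrightarrow> v \<in> W \<Longrightarrow> (h u, h v) \<in> lt Y \<longleftrightarrow> key u < key v"
    using realise_ograph[of W key "forcing_adj X" forcing_color n, where ?'a = 'a] by blast
  have "\<exists>f. embeds f X Y \<and> (\<forall>x\<in>verts X. d (f x) = c x)"
    if d: "proper_coloring n Y d" and c: "c \<in> ?C" for d c
  proof -
    have dn: "d (h v) \<in> {1..n}" if "v \<in> W" for v
      using d that bij_betwE[OF h] by (auto simp: proper_coloring_def)
    have dE: "d (h u) \<noteq> d (h v)" if "u \<in> W" "v \<in> W" "forcing_adj X u v" for u v
      using d edges[OF that(1,2)] that(3) by (auto simp: proper_coloring_def)
    define p where "p i = d (h (Inl i))" for i
    have inlW: "Inl i \<in> W" if "i \<in> {1..n}" for i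
      using that by (simp add: W_def)
    have inj: "inj_on p {1..n}"
      using dE inlW by (intro inj_onI) (fastforce simp: p_def)
    have "p ` {1..n} \<subseteq> {1..n}"
      using dn inlW by (auto simp: p_def)
    then have surj: "p ` {1..n} = {1..n}"
      using endo_inj_surj[OF finite_atLeastAtMost _ inj] by blast
    define b where "b = restrict (the_inv_into {1..n} p \<circ> c) (verts X)"
    have pb: "p (b x) = c x" and bn: "b x \<in> {1..n}" if "x \<in> verts X" for x
      using properC(1)[OF c that] f_the_inv_into_f[OF inj] the_inv_into_into[OF inj _ subset_refl]
        that surj by (simp_all add: b_def)
    have "b x \<noteq> b y" if "(x, y) \<in> edges X" for x y
      using properC(2)[OF c, of x y] pb that edgeX[OF that] by metis
    moreover have "b \<in> extensional (verts X)" by (simp add: b_def)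
    ultimately have b: "b \<in> ?C"
      using bn by (auto simp: colorings_def proper_coloring_def)
    then have inrW: "Inr (b, x) \<in> W" if "x \<in> verts X" for x
      using that by (simp add: W_def)
    have "d (h (Inr (b, x))) = c x" if x: "x \<in> verts X" for x
    proof -
      \<comment> \<open>The clique uses all \<open>n\<close> colors, so some clique vertex
        \<open>j\<close> has the color of this vertex. It cannot be adjacent to it, and the only
        clique vertex not joined to it is \<open>b x\<close>.\<close>
      obtain j where j: "j \<in> {1..n}" "p j = d (h (Inr (b, x)))"
        using dn[OF inrW[OF x]] surj by (metis imageE)
      then have "j = b x"
        using dE[OF inlW inrW[OF x], of j] by (auto simp: p_def)
      then show ?thesis using j pb[OF x] by simp
    qed
    moreover have "embeds (\<lambda>x. h (Inr (b, x))) X Y"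
      using inrW bij_betwE[OF h] edges lt rank_less_iff[OF X]
      by (simp add: embeds_def key_def)
    ultimately show ?thesis by blast
  qed
  then show ?thesis using that Y by blast
qed

lemma ramsey_bound_ge_sigma:
  fixes X :: "'a::infinite ograph"
  assumes X: "X \<in> colorable_ographs n" and s: "ramsey_bound (colorable_ographs n) X s"
  shows "sigma n X \<le> s"
proof -
  let ?C = "colorings n X"
  have finX: "finite_ograph X" using X by (simp add: colorable_ographs_def)
  obtain Y :: "'a ograph" where Y: "Y \<in> colorable_ographs n"
    and force: "\<And>d c. proper_coloring n Y d \<Longrightarrow> c \<in> ?C \<Longrightarrow>
      \<exists>f. embeds f X Y \<and> (\<forall>x\<in>verts X. d (f x) = c x)"
    using color_forcing_graph[OF finX] by blast
  obtain Z where Z: "Z \<in> colorable_ographs n" and arrow: "arrow Z Y X (card ?C) s"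
    using s Y by (auto simp: ramsey_bound_def)
  have finY: "finite_ograph Y" and finZ: "finite_ograph Z"
    using Y Z by (auto simp: colorable_ographs_def)
  obtain d where d: "proper_coloring n Z d"
    using Z by (auto simp: colorable_ographs_def)
  obtain idx where idx: "bij_betw idx ?C {1..card ?C}"
    using finite_same_card_bij[OF finite_colorings[OF finX], of "{1..card ?C}" n] by auto
  \<comment> \<open>One embedding is picked for every copy of \<open>X\<close>, and
    \<open>\<alpha>\<close> records the coloring that \<open>d\<close> induces along it.\<close>
  define emb where "emb C = (SOME f. embeds f X Z \<and> C = induced Z (f ` verts X))" for C
  define \<alpha> where "\<alpha> C = idx (restrict (d \<circ> emb C) (verts X))" for C
  have emb: "embeds (emb C) X Z \<and> C = induced Z (emb C ` verts X)" if "C \<in> copies X Z" for C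
  proof -
    have "\<exists>f. embeds f X Z \<and> C = induced Z (f ` verts X)"
      using that copies_eq[OF finX finZ] by blast
    from someI_ex[OF this] show ?thesis by (simp only: emb_def)
  qed
  have \<alpha>: "\<alpha> \<in> copies X Z \<rightarrow> {1..card ?C}"
    using proper_coloring_comp[OF d _ finX] emb bij_betwE[OF idx] unfolding \<alpha>_def by blast
  then obtain Y' where Y': "Y' \<in> copies Y Z" "card (\<alpha> ` copies X Y') \<le> s"
    using arrow by (auto simp: arrow_def)
  then obtain g where g: "embeds g Y Z" "Y' = induced Z (g ` verts Y)"
    using copies_eq[OF finY finZ] by auto
  have copies: "copies X Y' = {induced Z ((g \<circ> f) ` verts X) |f. embeds f X Y}"
    unfolding g(2) by (rule copies_copy[OF finX finY finZ g(1)])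
  then have "copies X Y' \<subseteq> copies X Z"
    using embeds_comp[OF _ g(1)] copies_eq[OF finX finZ] by blast
  then have "\<alpha> ` copies X Y' \<subseteq> {1..card ?C}"
    using \<alpha> by blast
  then have "finite (\<alpha> ` copies X Y')"
    by (rule finite_subset) simp
  moreover have "idx c \<in> \<alpha> ` copies X Y'" if c: "c \<in> ?C" for c
  proof -
    have "proper_coloring n Y (restrict (d \<circ> g) (verts Y))"
      using proper_coloring_comp[OF d g(1) finY] by (simp add: colorings_def)
    then obtain f where f: "embeds f X Y" "\<forall>x\<in>verts X. restrict (d \<circ> g) (verts Y) (f x) = c x"
      using force[OF _ c] by blast
    define C where "C = induced Z ((g \<circ> f) ` verts X)"
    have gf: "embeds (g \<circ> f) X Z" using embeds_comp[OF f(1) g(1)] .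
    then have C: "C \<in> copies X Z" "C \<in> copies X Y'"
      using copies copies_eq[OF finX finZ] f(1) by (auto simp: C_def)
    \<comment> \<open>By rigidity the embedding picked for \<open>C\<close> agrees with
      \<open>g \<circ> f\<close>, along which \<open>d\<close> induces \<open>c\<close>.\<close>
    have "ograph_iso (g \<circ> f) X C" "ograph_iso (emb C) X C"
      using embeds_iso[OF gf finX finZ] embeds_iso[OF _ finX finZ, of "emb C"] emb[OF C(1)]
      by (simp_all add: C_def)
    moreover have "finite_ograph C"
      unfolding C_def using gf by (intro finite_ograph_induced[OF finZ]) (auto simp: embeds_def)
    ultimately have "emb C x = g (f x)" if "x \<in> verts X" for x
      using ograph_iso_unique[OF _ _ finX] that by (metis comp_apply)
    moreover have "d (g (f x)) = c x" if "x \<in> verts X" for x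
    proof -
      have "f x \<in> verts Y" using f(1) that by (auto simp: embeds_def)
      then show ?thesis using bspec[OF f(2) that] by simp
    qed
    ultimately have "restrict (d \<circ> emb C) (verts X) = c"
      using c by (intro extensionalityI[of _ "verts X"]) (simp_all add: colorings_def)
    then show ?thesis using C(2) by (auto simp: \<alpha>_def)
  qed
  then have "idx ` ?C \<subseteq> \<alpha> ` copies X Y'"
    by (rule image_subsetI)
  then have "{1..card ?C} \<subseteq> \<alpha> ` copies X Y'"
    by (simp only: bij_betw_imp_surj_on[OF idx])
  ultimately have "card {1..card ?C} \<le> card (\<alpha> ` copies X Y')"
    by (intro card_mono)
  then show ?thesis
    using Y'(2) sigma_eq_card_colorings[OF finX, of n] by simp
qed

subsection \<open>The upper bound\<close>

text \<open>Ramsey's theorem for colors from any finite set; in the application a color is a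
  function that records one value for each proper coloring of \<open>X\<close>.\<close>

lemma ramsey_finite_range:
  assumes C: "finite C"
  shows "\<exists>p :: nat. \<forall>\<chi> \<in> nsets {..<p} a \<rightarrow> C.
    \<exists>H\<in>nsets {..<p} b. \<exists>d. \<forall>S\<in>nsets H a. \<chi> S = d"
proof -
  obtain h where h: "bij_betw h C {..<card C}"
    using ex_bij_betw_finite_nat[OF C] by (auto simp: atLeast0LessThan)
  obtain p :: nat where p: "partn_lst {..<p} (replicate (card C) b) a"
    using ramsey_full by blast
  have "\<exists>H\<in>nsets {..<p} b. \<exists>d. \<forall>S\<in>nsets H a. \<chi> S = d" if \<chi>: "\<chi> \<in> nsets {..<p} a \<rightarrow> C" for \<chi>
  proof -
    have "h \<circ> \<chi> \<in> nsets {..<p} a \<rightarrow> {..<card C}"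
      using \<chi> bij_betwE[OF h] by fastforce
    from partn_lstE[OF p this] obtain i H where i: "i < card C"
      and "H \<in> nsets {..<p} (replicate (card C) b ! i)" and hom: "(h \<circ> \<chi>) ` nsets H a \<subseteq> {i}"
      by auto
    then have H: "H \<in> nsets {..<p} b" by simp
    have "\<chi> S = the_inv_into C h i" if "S \<in> nsets H a" for S
    proof -
      have "S \<in> nsets {..<p} a"
        using that H nsets_mono[of H "{..<p}"] by (auto simp: nsets_def)
      then have "\<chi> S \<in> C" using \<chi> by blast
      moreover have "h (\<chi> S) = i" using hom that by auto
      ultimately show ?thesis
        using the_inv_into_f_f[OF bij_betw_imp_inj_on[OF h]] by metis
    qed
    then show ?thesis using H by blast
  qed
  then show ?thesis by blast
qed

text \<open>Listing the values of \<open>\<phi>\<close> by the ranks of their arguments gives a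
  strictly increasing list, and a finite set has only one such list.\<close>

lemma nth_rank_sorted_list:
  fixes \<phi> :: "'a \<Rightarrow> nat"
  assumes X: "finite_ograph X" and mono: "\<And>x y. (x, y) \<in> lt X \<Longrightarrow> \<phi> x < \<phi> y" and x: "x \<in> verts X"
  shows "sorted_list_of_set (\<phi> ` verts X) ! rank X x = \<phi> x"
proof -
  let ?e = "the_inv_into (verts X) (rank X)" and ?a = "card (verts X)"
  note bij = bij_betw_rank[OF X]
  have e: "?e i \<in> verts X" "rank X (?e i) = i" if "i < ?a" for i
    using that bij f_the_inv_into_f_bij_betw[OF bij] bij_betwE[OF bij_betw_the_inv_into[OF bij]] by auto
  have "sorted_wrt (<) (map (\<phi> \<circ> ?e) [0..<?a])"
    unfolding sorted_wrt_iff_nth_less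
  proof (intro allI impI)
    fix i j assume ij: "i < j" "j < length (map (\<phi> \<circ> ?e) [0..<?a])"
    then have "(?e i, ?e j) \<in> lt X"
      using e rank_less_iff[OF X e(1) e(1), of i j] by simp
    then show "map (\<phi> \<circ> ?e) [0..<?a] ! i < map (\<phi> \<circ> ?e) [0..<?a] ! j"
      using ij mono by simp
  qed
  moreover have "?e ` {0..<?a} = verts X"
    using bij_betw_the_inv_into[OF bij] by (simp add: bij_betw_def atLeast0LessThan)
  then have "set (map (\<phi> \<circ> ?e) [0..<?a]) = \<phi> ` verts X"
    by (simp only: set_map set_upt image_comp[symmetric])
  moreover have "finite (\<phi> ` verts X)"
    using X by (simp add: finite_ograph_def)
  ultimately have "sorted_list_of_set (\<phi> ` verts X) = map (\<phi> \<circ> ?e) [0..<?a]"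
    by (intro strict_sorted_equal) auto
  moreover have "rank X x < ?a"
    using bij_betwE[OF bij] x by auto
  ultimately show ?thesis
    using x inj_on_rank[OF X] by (simp add: the_inv_into_f_f)
qed

text \<open>In the partite graph below a part is a pair (block, color); \<open>place S X c x\<close> is the part
  of the vertex \<open>x\<close> in the copy of the colored graph \<open>(X, c)\<close> spread over the set \<open>S\<close> of blocks.\<close>

definition place :: "nat set \<Rightarrow> 'a ograph \<Rightarrow> ('a \<Rightarrow> nat) \<Rightarrow> 'a \<Rightarrow> nat \<times> nat" where
  "place S X c x = (sorted_list_of_set S ! rank X x, c x)"

definition placed_edges :: "nat set \<Rightarrow> 'a ograph \<Rightarrow> ('a \<Rightarrow> nat) \<Rightarrow> ((nat \<times> nat) \<times> (nat \<times> nat)) set" where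
  "placed_edges S X c = (\<lambda>(x, y). (place S X c x, place S X c y)) ` edges X"

lemma sorted_nth_less_iff:
  fixes H :: "nat set"
  assumes "finite H" "i < card H" "j < card H"
  shows "sorted_list_of_set H ! i < sorted_list_of_set H ! j \<longleftrightarrow> i < j"
  using assms sorted_wrt_nth_less[OF strict_sorted_list_of_set, of _ _ H]
  by (metis length_sorted_list_of_set linorder_neqE_nat less_asym less_irrefl)

lemma ramsey_bound_sigma:
  fixes X :: "'a::infinite ograph"
  assumes X: "X \<in> colorable_ographs n"
  shows "ramsey_bound (colorable_ographs n) X (sigma n X)"
  unfolding ramsey_bound_def
proof (intro ballI allI)
  fix Y :: "'a ograph" and k :: nat
  assume Y: "Y \<in> colorable_ographs n"
  have finX: "finite_ograph X" and finY: "finite_ograph Y"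
    using X Y by (auto simp: colorable_ographs_def)
  obtain c where c: "proper_coloring n Y c"
    using Y by (auto simp: colorable_ographs_def)
  let ?a = "card (verts X)" and ?b = "card (verts Y)" and ?L = "colorings n X"
  have fin_verts: "finite (verts X)" "finite (verts Y)"
    using finX finY by (auto simp: finite_ograph_def)
  have edgeX: "x \<in> verts X \<and> y \<in> verts X" if "(x, y) \<in> edges X" for x y
    using finX that by (auto simp: finite_ograph_def)
  have "finite (?L \<rightarrow>\<^sub>E {..k})"
    using finite_colorings[OF finX] by (intro finite_PiE) auto
  from ramsey_finite_range[OF this, of ?a ?b] obtain p :: nat
    where p: "\<forall>\<chi> \<in> nsets {..<p} ?a \<rightarrow> (?L \<rightarrow>\<^sub>E {..k}).
      \<exists>H\<in>nsets {..<p} ?b. \<exists>d. \<forall>S\<in>nsets H ?a. \<chi> S = d"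
    by (elim exE)
  \<comment> \<open>Vertices of \<open>Y\<close> are stored by their ranks, because they have to be
    coded as numbers and \<open>'a\<close> need not be countable; \<open>e\<close> recovers
    them.\<close>
  define e where "e = the_inv_into (verts Y) (rank Y)"
  have e: "e (rank Y y) = y" if "y \<in> verts Y" for y
    using that inj_on_rank[OF finY] by (simp add: e_def the_inv_into_f_f)
  define vtx where "vtx hs y = to_nat (hs, rank Y y)" for hs :: "nat list" and y
  \<comment> \<open>Disjoint copies of \<open>Y\<close>, one for each choice \<open>H\<close> of
    \<open>?b\<close> blocks, with the vertices placed in the blocks of \<open>H\<close> in
    increasing order.\<close>
  define V0 where "V0 = (\<lambda>(H, y). vtx (sorted_list_of_set H) y) ` (nsets {..<p} ?b \<times> verts Y)"
  define \<pi>0 where "\<pi>0 v = (let (hs, j) = from_nat v :: nat list \<times> nat in (hs ! j, c (e j)))" for v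
  define E0 where "E0 u v \<longleftrightarrow> (let (hs, i) = from_nat u :: nat list \<times> nat; (hs', j) = from_nat v
      in hs = hs' \<and> (e i, e j) \<in> edges Y)" for u v
  have \<pi>0: "\<pi>0 (vtx hs y) = (hs ! rank Y y, c y)" if "y \<in> verts Y" for hs y
    using that e by (simp add: \<pi>0_def vtx_def)
  have E0: "E0 (vtx hs x) (vtx hs y) \<longleftrightarrow> (x, y) \<in> edges Y" if "x \<in> verts Y" "y \<in> verts Y" for hs x y
    using that e by (simp add: E0_def vtx_def)
  have finV0: "finite V0"
    unfolding V0_def using fin_verts by (intro finite_imageI finite_cartesian_product finite_imp_finite_nsets) auto
  \<comment> \<open>A finite family, since there are finitely many parts; it contains the
    prescription of every colored copy of \<open>X\<close> spread over \<open>?a\<close>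
    blocks.\<close>
  define \<T> where "\<T> = {(M, R). M \<subseteq> {..<p} \<times> {1..n} \<and> R \<subseteq> M \<times> M}"
  have "\<T> \<subseteq> Pow ({..<p} \<times> {1..n}) \<times> Pow (({..<p} \<times> {1..n}) \<times> ({..<p} \<times> {1..n}))"
    by (auto simp: \<T>_def)
  then have "finite \<T>" by (rule finite_subset) simp
  moreover have "\<forall>(M, R)\<in>\<T>. R \<subseteq> M \<times> M" by (auto simp: \<T>_def)
  ultimately obtain V :: "nat set" and \<pi> E where finV: "finite V"
    and part: "\<forall>\<alpha>. (\<forall>T. \<alpha> T < Suc k) \<longrightarrow> (\<exists>f. partite_embedding f V0 \<pi>0 E0 V \<pi> E \<and>
        (\<forall>(M, R)\<in>\<T>. \<exists>i::nat. \<forall>T\<subseteq>V0. transversal \<pi>0 E0 M R T \<longrightarrow> \<alpha> (f ` T) = i))"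
    using partite_construction[OF _ finV0, of \<T> "Suc k" \<pi>0 E0] by (elim meta_impE exE conjE) auto
  define W where "W = {v \<in> V. snd (\<pi> v) \<in> {1..n}}"
  \<comment> \<open>Only the image of \<open>V0\<close> is under control, so \<open>E\<close> is
    made symmetric and its pairs of equal color are dropped. The edges that come from
    \<open>Y\<close> survive, because they are symmetric and \<open>c\<close> is proper.\<close>
  define adj where "adj u v \<longleftrightarrow> E u v \<and> E v u \<and> snd (\<pi> u) \<noteq> snd (\<pi> v)" for u v
  \<comment> \<open>Vertices are ordered by block; their numbers only break ties.\<close>
  define key where "key v = (fst (\<pi> v), v)" for v
  obtain Z :: "'a ograph" and h where Z: "Z \<in> colorable_ographs n" and h: "bij_betw h W (verts Z)"
    and edges: "\<And>u v. u \<in> W \<Longrightarrow> v \<in> W \<Longrightarrow> (h u, h v) \<in> edges Z \<longleftrightarrow> adj u v"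
    and lt: "\<And>u v. u \<in> W \<Longrightarrow> v \<in> W \<Longrightarrow> (h u, h v) \<in> lt Z \<longleftrightarrow> key u < key v"
  proof (rule realise_ograph[of W key adj "\<lambda>v. snd (\<pi> v)" n, where ?'a = 'a])
    show "finite W" using finV by (simp add: W_def)
    show "inj_on key W" by (simp add: inj_on_def key_def)
  qed (auto simp: W_def adj_def)
  have finZ: "finite_ograph Z" using Z by (simp add: colorable_ographs_def)
  have "arrow Z Y X k (sigma n X)"
    unfolding arrow_def
  proof (intro allI impI)
    fix \<alpha> assume \<alpha>: "\<alpha> \<in> copies X Z \<rightarrow> {1..k}"
    \<comment> \<open>Extends \<open>\<alpha>\<close> to all vertex sets; the default 0 is why
      \<open>Suc k\<close> colors were used.\<close>
    define \<beta> where
      "\<beta> T = (let C = induced Z (h ` T) in if C \<in> copies X Z then \<alpha> C else 0)" for T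
    have \<beta>_le: "\<beta> T < Suc k" for T
      using \<alpha> by (auto simp: \<beta>_def Let_def less_Suc_eq_le)
    obtain f where f: "partite_embedding f V0 \<pi>0 E0 V \<pi> E"
      and hom: "\<forall>(M, R)\<in>\<T>. \<exists>i. \<forall>T\<subseteq>V0. transversal \<pi>0 E0 M R T \<longrightarrow> \<beta> (f ` T) = i"
      using part \<beta>_le by blast
    let ?M = "\<lambda>S l. place S X l ` verts X" and ?R = "\<lambda>S l. placed_edges S X l"
    have "\<exists>i\<le>k. \<forall>T\<subseteq>V0. transversal \<pi>0 E0 (?M S l) (?R S l) T \<longrightarrow> \<beta> (f ` T) = i"
      if S: "S \<in> nsets {..<p} ?a" and l: "l \<in> ?L" for S l
    proof -
      have "sorted_list_of_set S ! rank X x \<in> S" if "x \<in> verts X" for x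
        using S that bij_betwE[OF bij_betw_rank[OF finX]] nth_mem[of "rank X x" "sorted_list_of_set S"]
        by (auto simp: nsets_def)
      then have "?M S l \<subseteq> {..<p} \<times> {1..n}"
        using S l by (auto simp: place_def nsets_def colorings_def proper_coloring_def)
      moreover have "?R S l \<subseteq> ?M S l \<times> ?M S l"
        using edgeX by (auto simp: placed_edges_def)
      ultimately have "(?M S l, ?R S l) \<in> \<T>" by (simp add: \<T>_def)
      from bspec[OF hom this] obtain i where i: "\<forall>T\<subseteq>V0. transversal \<pi>0 E0 (?M S l) (?R S l) T \<longrightarrow> \<beta> (f ` T) = i"
        by blast
      show ?thesis
      \<comment> \<open>If no transversal exists, \<open>i\<close> is not bounded by
        \<open>k\<close>, but then any value up to \<open>k\<close> will do.\<close>
      proof (cases "\<exists>T\<subseteq>V0. transversal \<pi>0 E0 (?M S l) (?R S l) T")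
        case True
        then have "i \<le> k" using i \<beta>_le less_Suc_eq_le by blast
        then show ?thesis using i by blast
      qed blast
    qed
    then obtain \<chi> where \<chi>: "\<And>S l. S \<in> nsets {..<p} ?a \<Longrightarrow> l \<in> ?L \<Longrightarrow> \<chi> S l \<le> k \<and>
        (\<forall>T\<subseteq>V0. transversal \<pi>0 E0 (?M S l) (?R S l) T \<longrightarrow> \<beta> (f ` T) = \<chi> S l)"
      by metis
    \<comment> \<open>A set of blocks is colored by its entire list of values, one for each proper
      coloring of \<open>X\<close>; on the subsets of \<open>H\<close> this list is
      constant.\<close>
    have "(\<lambda>S. restrict (\<chi> S) ?L) \<in> nsets {..<p} ?a \<rightarrow> (?L \<rightarrow>\<^sub>E {..k})"
      using \<chi> by auto
    from bspec[OF p this] obtain H d where H: "H \<in> nsets {..<p} ?b"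
      and d: "\<forall>S\<in>nsets H ?a. restrict (\<chi> S) ?L = d"
      by blast
    define hs where "hs = sorted_list_of_set H"
    have cardH: "card H = ?b" "finite H" using H by (auto simp: nsets_def)
    have nth_less: "hs ! rank Y x < hs ! rank Y y \<longleftrightarrow> (x, y) \<in> lt Y"
      if "x \<in> verts Y" "y \<in> verts Y" for x y
      using that sorted_nth_less_iff[OF cardH(2)] rank_less_iff[OF finY that]
        bij_betwE[OF bij_betw_rank[OF finY]] cardH(1) by (simp add: hs_def)
    have nth_H: "hs ! rank Y y \<in> H" if "y \<in> verts Y" for y
      using that bij_betwE[OF bij_betw_rank[OF finY]] cardH nth_mem[of "rank Y y" hs]
      by (simp add: hs_def)
    have vtxV0: "vtx hs y \<in> V0" if "y \<in> verts Y" for y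
      using that H by (force simp: V0_def hs_def)
    have \<pi>f: "\<pi> (f (vtx hs y)) = (hs ! rank Y y, c y)" if "y \<in> verts Y" for y
      using that vtxV0 f \<pi>0 by (simp add: partite_embedding_def)
    have fW: "f (vtx hs y) \<in> W" if "y \<in> verts Y" for y
      using that vtxV0 f \<pi>f[OF that] c by (auto simp: W_def partite_embedding_def proper_coloring_def)
    define g where "g y = h (f (vtx hs y))" for y
    have g: "embeds g Y Z"
      unfolding embeds_def
    proof (intro conjI ballI)
      show "g \<in> verts Y \<rightarrow> verts Z"
        using fW bij_betwE[OF h] by (auto simp: g_def)
    next
      fix x y assume xy: "x \<in> verts Y" "y \<in> verts Y"
      have "E (f (vtx hs x)) (f (vtx hs y)) \<longleftrightarrow> (x, y) \<in> edges Y"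
        "E (f (vtx hs y)) (f (vtx hs x)) \<longleftrightarrow> (y, x) \<in> edges Y"
        using xy f vtxV0 E0 by (auto simp: partite_embedding_def)
      then show "(g x, g y) \<in> edges Z \<longleftrightarrow> (x, y) \<in> edges Y"
        using xy edges[OF fW fW] \<pi>f finY c
        by (auto simp: g_def adj_def finite_ograph_def proper_coloring_def dest: symD)
      \<comment> \<open>Distinct vertices of \<open>Y\<close> lie in distinct blocks, so the
        comparison is decided by the blocks alone.\<close>
      have "key (f (vtx hs x)) < key (f (vtx hs y)) \<longleftrightarrow> (x, y) \<in> lt Y"
        using nth_less[OF xy] nth_less[OF xy(2,1)] finite_ograph_lt(4,5)[OF finY] xy \<pi>f
        by (auto simp: key_def)
      then show "(g x, g y) \<in> lt Z \<longleftrightarrow> (x, y) \<in> lt Y"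
        using lt[OF fW[OF xy(1)] fW[OF xy(2)]] by (simp add: g_def)
    qed
    define Y' where "Y' = induced Z (g ` verts Y)"
    have "Y' \<in> copies Y Z"
      using g copies_eq[OF finY finZ] by (auto simp: Y'_def)
    moreover have "\<alpha> C \<in> d ` ?L" if "C \<in> copies X Y'" for C
    proof -
      obtain u where u: "embeds u X Y" and C: "C = induced Z ((g \<circ> u) ` verts X)"
        using \<open>C \<in> copies X Y'\<close> copies_copy[OF finX finY finZ g] by (auto simp: Y'_def)
      have uY: "u x \<in> verts Y" if "x \<in> verts X" for x
        using u that by (auto simp: embeds_def)
      \<comment> \<open>The copy of \<open>X\<close> is described by its coloring \<open>l\<close>
        and the set \<open>S\<close> of blocks that it meets; its value will turn out to be
        \<open>d l\<close>.\<close>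
      define l where "l = restrict (c \<circ> u) (verts X)"
      have l: "l \<in> ?L" using proper_coloring_comp[OF c u finX] by (simp add: l_def)
      define \<phi> where "\<phi> x = hs ! rank Y (u x)" for x
      define S where "S = \<phi> ` verts X"
      have mono: "\<phi> x < \<phi> y" if "(x, y) \<in> lt X" for x y
        using that finite_ograph_lt(2)[OF finX that] u nth_less[OF uY uY]
        by (auto simp: \<phi>_def embeds_def)
      then have inj: "inj_on \<phi> (verts X)"
        using finite_ograph_lt(5)[OF finX] by (metis inj_onI less_irrefl)
      have SH: "S \<in> nsets H ?a"
        using nth_H[OF uY] fin_verts card_image[OF inj] by (auto simp: S_def \<phi>_def nsets_def)
      then have Sp: "S \<in> nsets {..<p} ?a"
        using H by (auto simp: nsets_def)
      have place: "place S X l x = \<pi>0 (vtx hs (u x))" if "x \<in> verts X" for x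
        using nth_rank_sorted_list[OF finX mono that] that \<pi>0[OF uY[OF that]]
        by (simp add: place_def S_def \<phi>_def l_def)
      have inj_place: "inj_on (place S X l) (verts X)"
        using inj \<pi>0 uY place by (auto simp: inj_on_def \<phi>_def)
      \<comment> \<open>The same copy of \<open>X\<close> seen inside \<open>V0\<close>: a
        transversal of the type prescribed by \<open>S\<close> and \<open>l\<close>.\<close>
      define T where "T = (\<lambda>x. vtx hs (u x)) ` verts X"
      have T: "T \<subseteq> V0" using vtxV0 uY by (auto simp: T_def)
      have "\<pi>0 ` T = ?M S l"
        using place by (auto simp: T_def)
      moreover have "inj_on \<pi>0 T"
        using inj_place place by (auto simp: T_def inj_on_def)
      moreover have "E0 (vtx hs (u x)) (vtx hs (u y)) \<longleftrightarrow> (place S X l x, place S X l y) \<in> ?R S l"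
        if xy: "x \<in> verts X" "y \<in> verts X" for x y
      proof -
        have "E0 (vtx hs (u x)) (vtx hs (u y)) \<longleftrightarrow> (x, y) \<in> edges X"
          using E0[OF uY uY] xy u by (simp add: embeds_def)
        also have "\<dots> \<longleftrightarrow> (place S X l x, place S X l y) \<in> ?R S l"
          using edgeX inj_on_eq_iff[OF inj_place] xy by (force simp: placed_edges_def)
        finally show ?thesis .
      qed
      ultimately have "transversal \<pi>0 E0 (?M S l) (?R S l) T"
        using place by (auto simp: transversal_def bij_betw_def T_def)
      then have "\<beta> (f ` T) = \<chi> S l"
        using \<chi>[OF Sp l] T by blast
      also have "\<dots> = d l"
        using d SH l by (metis restrict_apply')
      finally have "\<beta> (f ` T) = d l" .
      moreover have "C = induced Z (h ` f ` T)"
        by (simp add: C T_def g_def image_comp comp_def)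
      moreover have "C \<in> copies X Z"
        using embeds_comp[OF u g] C copies_eq[OF finX finZ] by blast
      ultimately show ?thesis
        using l by (auto simp: \<beta>_def Let_def)
    qed
    then have "\<alpha> ` copies X Y' \<subseteq> d ` ?L" by blast
    then have "card (\<alpha> ` copies X Y') \<le> sigma n X"
      unfolding sigma_eq_card_colorings[OF finX]
      using finite_colorings[OF finX] surj_card_le by blast
    ultimately show "\<exists>Y'\<in>copies Y Z. card (\<alpha> ` copies X Y') \<le> sigma n X"
      by blast
  qed
  then show "\<exists>Z\<in>colorable_ographs n. arrow Z Y X k (sigma n X)"
    using Z by blast
qed

theorem theorem1p2:
  fixes n :: nat and X :: "'a::infinite ograph"
  assumes "n \<ge> 1" and "X \<in> colorable_ographs n"
  shows "has_ramsey_degree (colorable_ographs n) X (sigma n X)"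
  unfolding has_ramsey_degree_def
  using ramsey_bound_sigma[OF assms(2)] ramsey_bound_ge_sigma[OF assms(2)] by blast

end
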